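(* Let $\{(X^t,Y^t)\}_{t\ge 0}$ be a time-homogeneous Markov chain on $(\mathcal X\times\mathcal Y,\ \mathcal B_{\mathcal X}\times\mathcal B_{\mathcal Y})$ satisfying the following conditions. (A0) For all $x\in\mathcal X$, $y\in\mathcal Y$: $\mathbf P_{x,y}(X^1\in\cdot)=\mathbf P_x(X^1\in\cdot)$ (the law of $X^1$ does not depend on $y$), so that $\{X^t\}$ is itself a Markov chain. (A1) The Markov chain $\{X^t\}$ is aperiodic. (A2) There is a set $V\in\mathcal B_{\mathcal X}$ such that $\tau=\min\{t\ge1: X^t\in V\}$ satisfies $\tau<\infty$ $\mathbf P_x$-a.s. for every $x\in\mathcal X$, and $\sup_{x\in V}\mathbf E_x\tau<\infty$. (A3) There exist a number $0<p\le1$, a probability measure $\mu$ on $(\mathcal X,\mathcal B_{\mathcal X})$ and an integer $m\ge1$ such that $\mathbf P_x(X^m\in\cdot)\ge p\,\mu(\cdot)$ for all $x\in V$. Let $\pi$ denote the stationary distribution of $\{X^t\}$ (it exists and is unique under A0--A3). Suppose there is a measurable function $L_2:\mathcal Y\to[0,\infty)$ such that: (B1) $\sup_{x\in\mathcal X,\,y\in\mathcal Y}\mathbf E_{x,y}|L_2(Y^1)-L_2(Y^0)|\le U<\infty$ for some constant $U$. (B2) There exist a non-negative, non-increasing function $h:[0,\infty)\to[0,\infty)$ with $h(N)\downarrow0$ as $N\to\infty$, and a measurable function $f:\mathcal X\to(-\infty,\infty)$ such that $\int_{\mathcal X}f(x)\,\pi(dx)=:-\varepsilon<0$ and, for all $x\in\mathcal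 X$ and $y\in\mathcal Y$, $$\mathbf E_{x,y}\bigl(L_2(Y^1)-L_2(y)\bigr)\le f(x)+h(L_2(y)).$$ Then there exists $N_0$ such that the set $D:=V\times\{y\in\mathcal Y: L_2(y)\le N_0\}$ is positive recurrent for the Markov chain $\{(X^t,Y^t)\}$.
   Context: $(\mathcal X,\mathcal B_{\mathcal X})$ and $(\mathcal Y,\mathcal B_{\mathcal Y})$ are measurable spaces with countably generated sigma-algebras, and $\mathcal B_{\mathcal X}\times\mathcal B_{\mathcal Y}$ is the product sigma-algebra. $\mathbf P_x,\mathbf E_x$ denote probability and expectation given $X^0=x$; $\mathbf P_{x,y},\mathbf E_{x,y}$ denote probability and expectation given $X^0=x,\ Y^0=y$. A measurable set $D$ is called positive recurrent for a Markov chain $\{Z^t\}$ if, with $\tau(D)=\min\{t\ge1:Z^t\in D\}$, one has $\tau(D)<\infty$ a.s. for every initial state $Z^0=z$, and $\sup_{z\in D}\mathbf E_z\tau(D)<\infty$. *)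

theory Defs
  imports "HOL-Probability.Probability"
begin

definition countably_generated :: "'a measure \<Rightarrow> bool" where
  "countably_generated M \<longleftrightarrow>
     (\<exists>G. countable G \<and> G \<subseteq> Pow (space M) \<and> sets M = sigma_sets (space M) G)"

text \<open>
  The law on \<open>PiM UNIV (\<lambda>_. M)\<close> (the space of trajectories) of the time-homogeneous
  Markov chain with transition kernel \<open>K \<in> M \<rightarrow>\<^sub>M prob_algebra M\<close> and initial state \<open>z\<close>,
  obtained from the Ionescu-Tulcea theorem. The state at time \<open>t\<close> is the coordinate map
  \<open>\<lambda>\<omega>. \<omega> t\<close>. Lemmas \<open>path_law_start\<close> and \<open>path_law_markov\<close> below characterise this law.
\<close>

definition path_step :: "'s measure \<Rightarrow> ('s \<Rightarrow> 's measure) \<Rightarrow> 's \<Rightarrow> nat \<Rightarrow> (nat \<Rightarrow> 's) \<Rightarrow> 's measure" where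
  "path_step M K z t \<omega> = (case t of 0 \<Rightarrow> return M z | Suc s \<Rightarrow> K (\<omega> s))"

definition path_law :: "'s measure \<Rightarrow> ('s \<Rightarrow> 's measure) \<Rightarrow> 's \<Rightarrow> (nat \<Rightarrow> 's) measure" where
  "path_law M K z =
     projective_family.lim UNIV (Ionescu_Tulcea.CI (path_step M K z) (\<lambda>_. M)) (\<lambda>_. M)"

text \<open>\<open>\<infinity>\<close> if the trajectory does not visit \<open>D\<close> at any time \<open>t \<ge> 1\<close>.\<close>

definition return_time :: "'s set \<Rightarrow> (nat \<Rightarrow> 's) \<Rightarrow> enat" where
  "return_time D \<omega> = Inf (enat ` {t. 1 \<le> t \<and> \<omega> t \<in> D})"

definition positive_recurrent :: "'s measure \<Rightarrow> ('s \<Rightarrow> 's measure) \<Rightarrow> 's set \<Rightarrow> bool" where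
  "positive_recurrent M K D \<longleftrightarrow>
     D \<in> sets M \<and>
     (\<forall>z\<in>space M. AE \<omega> in path_law M K z. return_time D \<omega> < \<infinity>) \<and>
     (SUP z\<in>D. \<integral>\<^sup>+\<omega>. ennreal_of_enat (return_time D \<omega>) \<partial>path_law M K z) < \<infinity>"

definition stationary_distribution :: "'s measure \<Rightarrow> ('s \<Rightarrow> 's measure) \<Rightarrow> 's measure \<Rightarrow> bool" where
  "stationary_distribution M K \<pi> \<longleftrightarrow> \<pi> \<in> space (prob_algebra M) \<and> \<pi> \<bind> K = \<pi>"

text \<open>
  Aperiodicity on a general state space, following Meyn and Tweedie,
  Markov Chains and Stochastic Stability, Sections 4.2 and 5.4: the chain is
  \<open>\<psi>\<close>-irreducible, where \<open>\<psi>\<close> is a maximal irreducibility measure, and the largest \<open>d\<close> for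
  which a \<open>d\<close>-cycle exists is 1 (the whole space is always a 1-cycle).
\<close>

definition irreducibility_measure :: "'s measure \<Rightarrow> ('s \<Rightarrow> 's measure) \<Rightarrow> 's measure \<Rightarrow> bool" where
  "irreducibility_measure M K \<phi> \<longleftrightarrow>
     sets \<phi> = sets M \<and> sigma_finite_measure \<phi> \<and> emeasure \<phi> (space M) > 0 \<and>
     (\<forall>A\<in>sets M. emeasure \<phi> A > 0 \<longrightarrow>
       (\<forall>x\<in>space M. measure (path_law M K x) {\<omega>\<in>space (path_law M K x). return_time A \<omega> < \<infinity>} > 0))"

definition maximal_irreducibility_measure :: "'s measure \<Rightarrow> ('s \<Rightarrow> 's measure) \<Rightarrow> 's measure \<Rightarrow> bool" where
  "maximal_irreducibility_measure M K \<psi> \<longleftrightarrow>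
     irreducibility_measure M K \<psi> \<and>
     (\<forall>\<phi>. irreducibility_measure M K \<phi> \<longrightarrow> absolutely_continuous \<psi> \<phi>)"

definition cycle_sets :: "'s measure \<Rightarrow> ('s \<Rightarrow> 's measure) \<Rightarrow> 's measure \<Rightarrow> nat \<Rightarrow> (nat \<Rightarrow> 's set) \<Rightarrow> bool" where
  "cycle_sets M K \<psi> d C \<longleftrightarrow>
     (\<forall>i<d. C i \<in> sets M) \<and> disjoint_family_on C {..<d} \<and>
     (\<forall>i<d. \<forall>x\<in>C i. measure (K x) (C (Suc i mod d)) = 1) \<and>
     space M - (\<Union>i<d. C i) \<in> null_sets \<psi>"

definition aperiodic :: "'s measure \<Rightarrow> ('s \<Rightarrow> 's measure) \<Rightarrow> bool" where
  "aperiodic M K \<longleftrightarrow>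
     (\<exists>\<psi>. maximal_irreducibility_measure M K \<psi> \<and> \<not> (\<exists>d\<ge>2. \<exists>C. cycle_sets M K \<psi> d C))"

lemma Ionescu_Tulcea_path_step:
  assumes K: "K \<in> M \<rightarrow>\<^sub>M prob_algebra M" and z: "z \<in> space M"
  shows "Ionescu_Tulcea (path_step M K z) (\<lambda>_. M)"
proof (rule Ionescu_Tulcea.intro)
  have K': "K \<in> M \<rightarrow>\<^sub>M subprob_algebra M"
    using K by (rule measurable_prob_algebraD)
  show "path_step M K z i \<in> PiM {0..<i} (\<lambda>_. M) \<rightarrow>\<^sub>M subprob_algebra M" for i
  proof (cases i)
    case 0
    have "return M z \<in> space (subprob_algebra M)"
      using z by (rule measurable_space[OF return_measurable])
    then show ?thesis
      by (simp add: path_step_def[abs_def] 0)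
  next
    case (Suc s)
    have "(\<lambda>\<omega>. K (\<omega> s)) \<in> PiM {0..<i} (\<lambda>_. M) \<rightarrow>\<^sub>M subprob_algebra M"
      by (rule measurable_compose[OF _ K'], rule measurable_component_singleton) (simp add: Suc)
    then show ?thesis
      by (simp add: path_step_def[abs_def] Suc)
  qed
  fix i :: nat and \<omega> assume \<omega>: "\<omega> \<in> space (PiM {0..<i} (\<lambda>_. M))"
  show "prob_space (path_step M K z i \<omega>)"
  proof (cases i)
    case 0
    then show ?thesis using z by (simp add: path_step_def prob_space_return)
  next
    case (Suc s)
    then have "\<omega> s \<in> space M" using \<omega> by (auto simp: space_PiM PiE_iff)
    from measurable_space[OF K this] show ?thesis
      by (simp add: path_step_def Suc space_prob_algebra)
  qed
qed

lemma
  assumes K: "K \<in> M \<rightarrow>\<^sub>M prob_algebra M" and z: "z \<in> space M"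
  shows sets_path_law: "sets (path_law M K z) = sets (PiM UNIV (\<lambda>_. M))"
    and prob_space_path_law: "prob_space (path_law M K z)"
    and path_law_start: "distr (path_law M K z) M (\<lambda>\<omega>. \<omega> 0) = return M z"
    and path_law_markov: "\<And>A B n. A \<in> sets M \<Longrightarrow> B \<in> sets (PiM {0..<Suc n} (\<lambda>_. M)) \<Longrightarrow>
      emeasure (path_law M K z)
        {\<omega>\<in>space (path_law M K z). restrict \<omega> {0..<Suc n} \<in> B \<and> \<omega> (Suc n) \<in> A} =
      (\<integral>\<^sup>+\<omega>. indicator B (restrict \<omega> {0..<Suc n}) * emeasure (K (\<omega> n)) A \<partial>path_law M K z)"
proof -
  interpret IT: Ionescu_Tulcea "path_step M K z" "\<lambda>_. M"
    using K z by (rule Ionescu_Tulcea_path_step)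
  let ?P = "path_law M K z" and ?u = "\<lambda>_::nat. undefined :: 'a"
  have lim: "?P = IT.PF.lim" by (simp add: path_law_def)
  show s: "sets ?P = sets (PiM UNIV (\<lambda>_. M))" by (simp add: lim)
  have sp: "space ?P = space (PiM UNIV (\<lambda>_. M))" by (rule sets_eq_imp_space_eq[OF s])
  have CI: "distr ?P (PiM {0..<n} (\<lambda>_. M)) (\<lambda>\<omega>. restrict \<omega> {0..<n}) = IT.C 0 n ?u" for n
  proof -
    have "distr ?P (PiM {0..<n} (\<lambda>_. M)) (\<lambda>\<omega>. restrict \<omega> {0..<n}) = IT.CI {0..<n}"
      unfolding lim by (rule IT.distr_lim) simp
    also have "\<dots> = IT.C 0 n ?u"
    proof (rule measure_eqI)
      show "sets (IT.CI {0..<n}) = sets (IT.C 0 n ?u)" by (simp add: IT.CI_def IT.sets_C)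
      fix X assume "X \<in> sets (IT.CI {0..<n})"
      then have X: "X \<in> sets (PiM {0..<n} (\<lambda>_. M))" by (simp add: IT.CI_def)
      show "emeasure (IT.CI {0..<n}) X = emeasure (IT.C 0 n ?u) X"
        using IT.emeasure_CI[OF subset_refl X] sets.sets_into_space[OF X]
        by (simp add: prod_emb_id space_PiM)
    qed
    finally show ?thesis .
  qed
  have meas: "(\<lambda>\<omega>. restrict \<omega> {0..<n}) \<in> ?P \<rightarrow>\<^sub>M PiM {0..<n} (\<lambda>_. M)" for n
    unfolding measurable_cong_sets[OF s refl] by (rule measurable_restrict_subset) simp
  have u: "?u \<in> space (PiM {0..<0} (\<lambda>_. M))" by (simp add: space_PiM)
  show "prob_space ?P"
    using IT.prob_space_C[OF u, of 0] unfolding CI[symmetric]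
    by (rule prob_space_distrD[OF meas])
  show "distr ?P M (\<lambda>\<omega>. \<omega> 0) = return M z"
  proof (rule measure_eqI)
    fix A assume "A \<in> sets (distr ?P M (\<lambda>\<omega>. \<omega> 0))"
    then have A[measurable]: "A \<in> sets M" by simp
    let ?A = "(\<lambda>\<omega>. \<omega> 0) -` A \<inter> space (PiM {0..<Suc 0} (\<lambda>_. M))"
    have c: "(\<lambda>\<omega>. \<omega> 0) \<in> PiM {0..<Suc 0} (\<lambda>_. M) \<rightarrow>\<^sub>M M" by simp
    have A': "?A \<in> sets (PiM {0..<Suc 0} (\<lambda>_. M))" using measurable_sets[OF c A] .
    have "emeasure (distr ?P M (\<lambda>\<omega>. \<omega> 0)) A = emeasure (distr ?P (PiM {0..<Suc 0} (\<lambda>_. M)) (\<lambda>\<omega>. restrict \<omega> {0..<Suc 0})) ?A"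
      by (subst (1 2) emeasure_distr[OF _ ])
         (auto intro!: arg_cong2[where f=emeasure] meas A' A simp: space_PiM PiE_iff measurable_cong_sets[OF s refl] sp)
    also have "\<dots> = emeasure (IT.C 0 (Suc 0) ?u) ?A" unfolding CI ..
    also have "IT.C 0 (Suc 0) ?u = IT.eP 0 ?u"
      using bind_return[OF IT.measurable_eP u] by simp
    also have "emeasure (IT.eP 0 ?u) ?A = indicator A z"
    proof -
      have "fun_upd ?u 0 -` ?A \<inter> space M = A"
        using sets.sets_into_space[OF A] by (auto simp: space_PiM PiE_iff extensional_def)
      then show ?thesis
        by (subst IT.emeasure_eP[OF u A']) (simp add: path_step_def)
    qed
    finally show "emeasure (distr ?P M (\<lambda>\<omega>. \<omega> 0)) A = emeasure (return M z) A" by simp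
  qed simp
  fix A B n assume A[measurable]: "A \<in> sets M" and B[measurable]: "B \<in> sets (PiM {0..<Suc n} (\<lambda>_. M))"
  have K'[measurable]: "K \<in> M \<rightarrow>\<^sub>M subprob_algebra M" using K by (rule measurable_prob_algebraD)
  let ?S = "PiM {0..<Suc (Suc n)} (\<lambda>_. M)" and ?R = "PiM {0..<Suc n} (\<lambda>_. M)"
  let ?E = "{\<omega>\<in>space ?S. restrict \<omega> {0..<Suc n} \<in> B \<and> \<omega> (Suc n) \<in> A}"
  have r: "(\<lambda>\<omega>. restrict \<omega> {0..<Suc n}) \<in> ?S \<rightarrow>\<^sub>M ?R" by (rule measurable_restrict_subset) auto
  have E: "?E \<in> sets ?S" using r by measurable
  have "emeasure ?P {\<omega>\<in>space ?P. restrict \<omega> {0..<Suc n} \<in> B \<and> \<omega> (Suc n) \<in> A} =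
     emeasure (distr ?P ?S (\<lambda>\<omega>. restrict \<omega> {0..<Suc (Suc n)})) ?E"
    by (subst emeasure_distr[OF meas E])
       (auto intro!: arg_cong2[where f=emeasure] simp: sp space_PiM PiE_iff Int_absorb1 min_def)
  also have "\<dots> = emeasure (IT.C 0 (Suc n) ?u \<bind> IT.eP (Suc n)) ?E" unfolding CI by simp
  also have "\<dots> = (\<integral>\<^sup>+\<omega>. emeasure (IT.eP (Suc n) \<omega>) ?E \<partial>IT.C 0 (Suc n) ?u)"
  proof (rule emeasure_bind[OF _ _ E])
    have sC: "sets (IT.C 0 (Suc n) ?u) = sets ?R"
      using IT.sets_C[OF u, of "Suc n"] by (simp only: add_0)
    show "space (IT.C 0 (Suc n) ?u) \<noteq> {}"
      by (rule prob_space.not_empty[OF IT.prob_space_C[OF u]])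
    show "IT.eP (Suc n) \<in> IT.C 0 (Suc n) ?u \<rightarrow>\<^sub>M subprob_algebra ?S"
      unfolding measurable_cong_sets[OF sC refl] by (rule IT.measurable_eP)
  qed
  also have "\<dots> = (\<integral>\<^sup>+\<omega>. indicator B \<omega> * emeasure (K (\<omega> n)) A \<partial>IT.C 0 (Suc n) ?u)"
  proof (rule nn_integral_cong)
    fix \<omega> assume "\<omega> \<in> space (IT.C 0 (Suc n) ?u)"
    then have w: "\<omega> \<in> space ?R" using IT.space_C[OF u, of "Suc n"] by simp
    then have wn: "\<omega> n \<in> space M" by (auto simp: space_PiM PiE_iff)
    have e: "restrict (fun_upd \<omega> (Suc n) x) {0..<Suc n} = \<omega>" for x
      using w by (auto simp: space_PiM PiE_iff extensional_def fun_eq_iff)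
    have i: "fun_upd \<omega> (Suc n) x \<in> space ?S" if "x \<in> space M" for x
      using w that by (auto simp: space_PiM PiE_iff extensional_def)
    have "emeasure (IT.eP (Suc n) \<omega>) ?E = emeasure (K (\<omega> n)) ((\<lambda>x. fun_upd \<omega> (Suc n) x) -` ?E \<inter> space M)"
      by (subst IT.emeasure_eP[OF w E]) (simp add: path_step_def)
    also have "(\<lambda>x. fun_upd \<omega> (Suc n) x) -` ?E \<inter> space M = (if \<omega> \<in> B then A else {})"
      using e i sets.sets_into_space[OF A] by auto
    also have "emeasure (K (\<omega> n)) \<dots> = indicator B \<omega> * emeasure (K (\<omega> n)) A"
      by simp
    finally show "emeasure (IT.eP (Suc n) \<omega>) ?E = indicator B \<omega> * emeasure (K (\<omega> n)) A" .
  qed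
  also have "\<dots> = (\<integral>\<^sup>+\<omega>. indicator B (restrict \<omega> {0..<Suc n}) * emeasure (K (\<omega> n)) A \<partial>?P)"
    unfolding CI[symmetric] by (subst nn_integral_distr[OF meas]) auto
  finally show "emeasure ?P {\<omega>\<in>space ?P. restrict \<omega> {0..<Suc n} \<in> B \<and> \<omega> (Suc n) \<in> A} =
      (\<integral>\<^sup>+\<omega>. indicator B (restrict \<omega> {0..<Suc n}) * emeasure (K (\<omega> n)) A \<partial>?P)" .
qed

end

theory Submission
  imports Defs
begin

text \<open>
  Watch the chain only at its visits to \<open>V\<close>. Let \<open>Q\<close> be the transition operator between successive
  visits and \<open>T x\<close> the mean return time. Summing (B2) along an excursion gives, with \<open>F = min f U + c\<close>
  for a constant \<open>c\<close> that makes \<open>F\<close> non-negative,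
  \<open>Q L2 + c T \<le> L2 + exc F + (error)\<close>, where \<open>exc F\<close> is the mean of \<open>F\<close> summed over the excursion. By
  Kac's formula the mean of \<open>exc F - c T\<close> over \<open>V\<close> under \<open>\<pi>\<close> is the integral of \<open>F - c\<close>, hence negative.
  The error consists of \<open>h N\<close> times \<open>T\<close> and of the time spent below the level \<open>N\<close>; before time \<open>n\<close> the
  latter is small by (B1) when the initial level is high, and after time \<open>n\<close> it depends on the first
  component only and has a small \<open>\<pi>\<close>-mean.

  It remains to replace these functions on \<open>V\<close> by their means. By (A3), a Cesaro mean of powers of \<open>Q\<close>
  satisfies Doeblin's condition on \<open>V\<close>, because \<open>P Q u \<le> Q u + Q Q u\<close> for the one-step operator \<open>P\<close>; so
  there is a bounded \<open>G\<close> that solves the Poisson equation for \<open>Q\<close> up to a small error. Then \<open>L2 + G\<close>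
  decreases by a fixed amount in mean between visits to \<open>V\<close> at high levels, and \<open>T + \<kappa> Q (L2 + G)\<close> for
  large \<open>\<kappa>\<close> bounds the mean hitting time of \<open>D\<close>.
\<close>

section \<open>Positive operators\<close>

text \<open>The obstacle is that (B2) controls \<open>f\<close> only in mean under
  \<open>\<pi>\<close>: from a given point of \<open>V\<close> an excursion may well raise
  \<open>L2\<close> in mean, so no drift holds from visit to visit before a bounded corrector is
  added. Also, bounded mean return times do not make the return times uniformly integrable over
  \<open>V\<close>: what happens after time \<open>n\<close> is small in \<open>\<pi>\<close>-mean
  but not uniformly on \<open>V\<close>. This tail is therefore put into the function that the
  Poisson equation averages, and \<open>n\<close> is fixed before any level is chosen.

  Powers of \<open>Q\<close> alone would not average: if \<open>V\<close> has two points and each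
  leads to the other after one or two steps, both with positive probability, the chain is aperiodic
  while \<open>Q\<close> swaps the points. Hence the Cesaro means.

  All functions take values in \<open>ennreal\<close>, which removes integrability questions along
  excursions. In return every negative term is moved to the other side of an inequality or shifted
  by a constant, and cancelling needs finiteness.\<close>

locale positive_operator =
  fixes M :: "'s measure" and V :: "'s set" and S :: "('s \<Rightarrow> ennreal) \<Rightarrow> 's \<Rightarrow> ennreal"
  assumes measurable_op: "u \<in> borel_measurable M \<Longrightarrow> S u \<in> borel_measurable M"
    and add: "u \<in> borel_measurable M \<Longrightarrow> v \<in> borel_measurable M \<Longrightarrow> x \<in> space M \<Longrightarrow>
      S (\<lambda>y. u y + v y) x = S u x + S v x"
    and cmult: "u \<in> borel_measurable M \<Longrightarrow> x \<in> space M \<Longrightarrow> S (\<lambda>y. c * u y) x = c * S u x"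
    and mono: "(\<And>y. y \<in> V \<Longrightarrow> u y \<le> v y) \<Longrightarrow> x \<in> space M \<Longrightarrow> S u x \<le> S v x"
begin

text \<open>Since \<open>mono\<close> compares arguments on \<open>V\<close> only, an operator is
  blind to values outside \<open>V\<close>. This is why \<open>V\<close> is a parameter of the
  locale: entering \<open>V\<close> and returning to \<open>V\<close> see only \<open>V\<close>, a
  step that avoids \<open>V\<close> sees only the complement.\<close>

lemma cong: "(\<And>y. y \<in> V \<Longrightarrow> u y = v y) \<Longrightarrow> x \<in> space M \<Longrightarrow> S u x = S v x"
  by (intro antisym mono) auto

lemma sum:
  assumes "\<And>i. i \<in> I \<Longrightarrow> u i \<in> borel_measurable M" and x: "x \<in> space M"
  shows "S (\<lambda>y. \<Sum>i\<in>I. u i y) x = (\<Sum>i\<in>I. S (u i) x)"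
  using assms(1)
proof (induction I rule: infinite_finite_induct)
  case (infinite I)
  then show ?case using cmult[of "\<lambda>_. 0" x 0] x by simp
next
  case empty
  then show ?case using cmult[of "\<lambda>_. 0" x 0] x by simp
next
  case (insert i I)
  have "S (\<lambda>y. u i y + (\<Sum>i\<in>I. u i y)) x = S (u i) x + S (\<lambda>y. \<Sum>i\<in>I. u i y) x"
    using insert.prems x by (intro add) auto
  then show ?case using insert by simp
qed

lemma const: "x \<in> space M \<Longrightarrow> S (\<lambda>_. c) x = c * S (\<lambda>_. 1) x"
  using cmult[of "\<lambda>_. 1" x c] by simp

end

lemma positive_operator_weaken:
  "positive_operator M V S \<Longrightarrow> V \<subseteq> V' \<Longrightarrow> positive_operator M V' S"
  unfolding positive_operator_def by blast

text \<open>The laws of the inner operator are available on \<open>space M\<close> only. This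
  suffices because the outer operator looks at \<open>V\<close>, which lies inside.\<close>

lemma positive_operator_comp:
  assumes "positive_operator M V S" "positive_operator M V' S'" "V \<subseteq> space M"
  shows "positive_operator M V' (\<lambda>u. S (S' u))"
proof -
  interpret S: positive_operator M V S by fact
  interpret S': positive_operator M V' S' by fact
  show ?thesis
  proof
    fix u v :: "_ \<Rightarrow> ennreal" and x c
    assume u: "u \<in> borel_measurable M" and x: "x \<in> space M"
    show "S (S' (\<lambda>y. c * u y)) x = c * S (S' u) x"
      using S.cong[of "S' (\<lambda>y. c * u y)" "\<lambda>y. c * S' u y" x] S'.cmult[OF u] x assms(3)
      by (auto simp: S.cmult S'.measurable_op u)
    assume v: "v \<in> borel_measurable M"
    show "S (S' (\<lambda>y. u y + v y)) x = S (S' u) x + S (S' v) x"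
      using S.cong[of "S' (\<lambda>y. u y + v y)" "\<lambda>y. S' u y + S' v y" x] S'.add[OF u v] x assms(3)
      by (auto simp: S.add S'.measurable_op u v)
  next
    fix u v :: "_ \<Rightarrow> ennreal" and x assume "\<And>y. y \<in> V' \<Longrightarrow> u y \<le> v y" "x \<in> space M"
    then show "S (S' u) x \<le> S (S' v) x"
      using assms(3) by (intro S.mono S'.mono) auto
  qed (simp add: S.measurable_op S'.measurable_op)
qed

lemma positive_operator_funpow_Suc:
  assumes "positive_operator M V S" "V \<subseteq> space M"
  shows "positive_operator M V (S ^^ Suc n)"
proof (induction n)
  case 0
  then show ?case using assms by simp
next
  case (Suc n)
  show ?case
    using positive_operator_comp[OF assms(1) Suc assms(2)] by (simp add: comp_def)
qed

text \<open>The zeroth power is the identity, which sees every point, so blindness outside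
  \<open>V\<close> is given up here.\<close>

lemma positive_operator_funpow:
  assumes "positive_operator M V S" "V \<subseteq> space M"
  shows "positive_operator M (space M) (S ^^ n)"
proof (cases n)
  case 0
  show ?thesis unfolding 0 by standard auto
next
  case (Suc k)
  show ?thesis unfolding Suc
    by (rule positive_operator_weaken[OF positive_operator_funpow_Suc[OF assms] assms(2)])
qed

lemma positive_operator_suminf:
  assumes "\<And>n::nat. positive_operator M V (S n)"
  shows "positive_operator M V (\<lambda>u x. \<Sum>n. S n u x)"
proof -
  interpret positive_operator M V "S n" for n by fact
  show ?thesis
  proof
    fix u v :: "_ \<Rightarrow> ennreal" and x assume "\<And>y. y \<in> V \<Longrightarrow> u y \<le> v y" "x \<in> space M"
    then show "(\<Sum>n. S n u x) \<le> (\<Sum>n. S n v x)"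
      by (intro suminf_le mono) auto
  qed (use measurable_op in \<open>simp_all add: add cmult suminf_add borel_measurable_suminf\<close>)
qed

lemma positive_operator_sum:
  assumes op: "\<And>n. n \<in> I \<Longrightarrow> positive_operator M V (S n)"
  shows "positive_operator M V (\<lambda>u x. \<Sum>n\<in>I. S n u x)"
proof
  fix u v :: "_ \<Rightarrow> ennreal" and x c
  assume u: "u \<in> borel_measurable M"
  show "(\<lambda>x. \<Sum>n\<in>I. S n u x) \<in> borel_measurable M"
    by (rule borel_measurable_sum) (rule positive_operator.measurable_op[OF op u])
  assume x: "x \<in> space M"
  show "(\<Sum>n\<in>I. S n (\<lambda>y. c * u y) x) = c * (\<Sum>n\<in>I. S n u x)"
    unfolding sum_distrib_left by (rule sum.cong[OF refl]) (rule positive_operator.cmult[OF op u x])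
  assume v: "v \<in> borel_measurable M"
  show "(\<Sum>n\<in>I. S n (\<lambda>y. u y + v y) x) = (\<Sum>n\<in>I. S n u x) + (\<Sum>n\<in>I. S n v x)"
    unfolding sum.distrib[symmetric] by (rule sum.cong[OF refl]) (rule positive_operator.add[OF op u v x])
next
  fix u v :: "_ \<Rightarrow> ennreal" and x assume "\<And>y. y \<in> V \<Longrightarrow> u y \<le> v y" "x \<in> space M"
  then show "(\<Sum>n\<in>I. S n u x) \<le> (\<Sum>n\<in>I. S n v x)"
    by (intro sum_mono positive_operator.mono[OF op])
qed

lemma positive_operator_scale:
  assumes "positive_operator M V S"
  shows "positive_operator M V (\<lambda>u x. a * S u x)"
proof -
  interpret positive_operator M V S by fact
  show ?thesis
    by standard (use measurable_op in \<open>simp_all add: add cmult distrib_left mult.left_commute mult_left_mono mono\<close>)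
qed

section \<open>Taboo steps and excursions\<close>

text \<open>The killed kernel: mass that lands outside \<open>C\<close> is lost, so the
  \<open>n\<close>-th power describes paths that lie in \<open>C\<close> at times 1 to
  \<open>n\<close>. For \<open>C = space M\<close> it is the transition operator itself.\<close>

definition step_in :: "('s \<Rightarrow> 's measure) \<Rightarrow> 's set \<Rightarrow> ('s \<Rightarrow> ennreal) \<Rightarrow> 's \<Rightarrow> ennreal" where
  "step_in K C u x = (\<integral>\<^sup>+y. indicator C y * u y \<partial>K x)"

text \<open>The mean of \<open>u\<close> summed over the times before the first return to
  \<open>V\<close>. Time 0 counts even when the start lies in \<open>V\<close>, so
  \<open>u = 1\<close> gives the mean return time.\<close>

definition excursion :: "'s measure \<Rightarrow> ('s \<Rightarrow> 's measure) \<Rightarrow> 's set \<Rightarrow> ('s \<Rightarrow> ennreal) \<Rightarrow> 's \<Rightarrow> ennreal" where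
  "excursion M K V u x = (\<Sum>n. (step_in K (space M - V) ^^ n) u x)"

text \<open>The mean of \<open>u\<close> at the first visit to \<open>V\<close> at a time at least
  1: the inner \<open>step_in K V u\<close> is the step that enters \<open>V\<close>, and the
  excursion sums over the time of that step.\<close>

definition return_op :: "'s measure \<Rightarrow> ('s \<Rightarrow> 's measure) \<Rightarrow> 's set \<Rightarrow> ('s \<Rightarrow> ennreal) \<Rightarrow> 's \<Rightarrow> ennreal" where
  "return_op M K V u = excursion M K V (step_in K V u)"

locale markov_kernel =
  fixes M :: "'s measure" and K :: "'s \<Rightarrow> 's measure"
  assumes kernel: "K \<in> M \<rightarrow>\<^sub>M prob_algebra M"
begin

lemma prob_space_kernel: "x \<in> space M \<Longrightarrow> prob_space (K x)"
  and sets_kernel: "x \<in> space M \<Longrightarrow> sets (K x) = sets M"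
  using measurable_space[OF kernel] by (auto simp: space_prob_algebra)

lemma space_kernel: "x \<in> space M \<Longrightarrow> space (K x) = space M"
  by (rule sets_eq_imp_space_eq[OF sets_kernel])

lemma measurable_kernel_iff: "x \<in> space M \<Longrightarrow> f \<in> K x \<rightarrow>\<^sub>M N \<longleftrightarrow> f \<in> M \<rightarrow>\<^sub>M N"
  by (simp add: measurable_cong_sets[OF sets_kernel refl])

lemma measurable_nn_integral_kernel:
  assumes "u \<in> borel_measurable M"
  shows "(\<lambda>x. \<integral>\<^sup>+y. u y \<partial>K x) \<in> borel_measurable M"
  using measurable_compose[OF measurable_prob_algebraD[OF kernel] nn_integral_measurable_subprob_algebra[OF assms]] .

lemma positive_operator_step_in:
  assumes C: "C \<in> sets M"
  shows "positive_operator M C (step_in K C)"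
proof
  fix u v :: "'s \<Rightarrow> ennreal" and x assume x: "x \<in> space M"
  have i[measurable]: "indicator C \<in> borel_measurable M" using C by simp
  {
    fix c
    assume u[measurable]: "u \<in> borel_measurable M"
    have "step_in K C (\<lambda>y. c * u y) x = (\<integral>\<^sup>+y. c * (indicator C y * u y) \<partial>K x)"
      by (simp add: step_in_def mult_ac)
    also have "\<dots> = c * step_in K C u x"
      unfolding step_in_def by (rule nn_integral_cmult) (simp add: measurable_kernel_iff x)
    finally show "step_in K C (\<lambda>y. c * u y) x = c * step_in K C u x" .
    assume v[measurable]: "v \<in> borel_measurable M"
    show "step_in K C (\<lambda>y. u y + v y) x = step_in K C u x + step_in K C v x"
      unfolding step_in_def distrib_left by (rule nn_integral_add) (simp_all add: measurable_kernel_iff x)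
  }
  assume "\<And>y. y \<in> C \<Longrightarrow> u y \<le> v y"
  then show "step_in K C u x \<le> step_in K C v x"
    unfolding step_in_def by (intro nn_integral_mono) (auto split: split_indicator)
next
  fix u :: "'s \<Rightarrow> ennreal" assume [measurable]: "u \<in> borel_measurable M"
  have i[measurable]: "indicator C \<in> borel_measurable M" using C by simp
  show "step_in K C u \<in> borel_measurable M"
    unfolding step_in_def[abs_def] by (rule measurable_nn_integral_kernel) measurable
qed

lemma step_in_suminf:
  assumes C: "C \<in> sets M" and u: "\<And>n. u n \<in> borel_measurable M" and x: "x \<in> space M"
  shows "step_in K C (\<lambda>y. \<Sum>n. u n y) x = (\<Sum>n. step_in K C (u n) x)"
proof -
  have "(\<lambda>y. indicator C y * u n y) \<in> borel_measurable (K x)" for n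
    unfolding measurable_kernel_iff[OF x] using C u by measurable
  then show ?thesis
    unfolding step_in_def by (subst nn_integral_suminf[symmetric]) auto
qed

lemma step_in_split:
  assumes C: "C \<in> sets M" and u: "u \<in> borel_measurable M" and x: "x \<in> space M"
  shows "step_in K C u x + step_in K (space M - C) u x = (\<integral>\<^sup>+y. u y \<partial>K x)"
proof -
  have m: "(\<lambda>y. indicator C y * u y) \<in> borel_measurable (K x)"
    "(\<lambda>y. indicator (space M - C) y * u y) \<in> borel_measurable (K x)"
    unfolding measurable_kernel_iff[OF x] using C u by measurable
  show ?thesis
    unfolding step_in_def nn_integral_add[OF m, symmetric]
    by (rule nn_integral_cong) (auto simp: space_kernel x split: split_indicator)
qed

lemma step_in_space:
  assumes "x \<in> space M"
  shows "step_in K (space M) u x = (\<integral>\<^sup>+y. u y \<partial>K x)"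
  unfolding step_in_def by (rule nn_integral_cong) (simp add: space_kernel assms)

lemma step_in_le_1: "x \<in> space M \<Longrightarrow> step_in K C (\<lambda>_. 1) x \<le> 1"
proof -
  assume x: "x \<in> space M"
  have "step_in K C (\<lambda>_. 1) x \<le> (\<integral>\<^sup>+y. 1 \<partial>K x)"
    unfolding step_in_def by (rule nn_integral_mono) (auto split: split_indicator)
  also have "\<dots> = 1" using prob_space.emeasure_space_1[OF prob_space_kernel[OF x]] by simp
  finally show ?thesis .
qed

lemma funpow_step_in_decseq:
  assumes C: "C \<in> sets M" and x: "x \<in> space M"
  shows "decseq (\<lambda>n. (step_in K C ^^ n) (\<lambda>_. 1) x)"
proof (rule decseq_SucI)
  fix n
  interpret positive_operator M "space M" "step_in K C ^^ n"
    by (rule positive_operator_funpow[OF positive_operator_step_in[OF C] sets.sets_into_space[OF C]])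
  show "(step_in K C ^^ Suc n) (\<lambda>_. 1) x \<le> (step_in K C ^^ n) (\<lambda>_. 1) x"
    unfolding funpow_Suc_right comp_def by (rule mono) (auto simp: step_in_le_1 x)
qed

end

section \<open>Path law and return times\<close>

text \<open>Turns a mean return time into the sum of its tail probabilities, which are powers of a
  taboo step.\<close>

lemma ennreal_of_enat_eq_suminf:
  "ennreal_of_enat r = (\<Sum>n. if enat n < r then 1 else 0)"
proof (cases r)
  case (enat k)
  have "(\<Sum>n. if enat n < r then 1 else 0 :: ennreal) = (\<Sum>n<k. if enat n < r then 1 else 0)"
    by (rule suminf_finite) (auto simp: enat)
  then show ?thesis by (simp add: enat)
next
  case infinity
  have "(\<Sum>n. 1 :: ennreal) = \<infinity>"
  proof (rule ccontr)
    assume "(\<Sum>n. 1 :: ennreal) \<noteq> \<infinity>"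
    then have "(\<Sum>n. ennreal 1) \<noteq> top" by simp
    from summable_suminf_not_top[OF _ this] have "summable (\<lambda>n::nat. 1 :: real)" by simp
    then show False by (simp add: summable_const_iff)
  qed
  then show ?thesis by (simp add: infinity)
qed

text \<open>Time 0 is not inspected, so both sides hold for \<open>n = 0\<close>, in agreement with
  the zeroth power of a taboo step.\<close>

lemma less_return_time_iff:
  "enat n < return_time A \<omega> \<longleftrightarrow> (\<forall>i\<in>{1..n}. \<omega> i \<notin> A)"
proof
  assume *: "enat n < return_time A \<omega>"
  show "\<forall>i\<in>{1..n}. \<omega> i \<notin> A"
  proof (intro ballI notI)
    fix i assume i: "i \<in> {1..n}" "\<omega> i \<in> A"
    then have "return_time A \<omega> \<le> enat i" unfolding return_time_def by (intro Inf_lower) auto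
    also have "\<dots> \<le> enat n" using i by simp
    finally show False using * by simp
  qed
next
  assume *: "\<forall>i\<in>{1..n}. \<omega> i \<notin> A"
  have "enat (Suc n) \<le> return_time A \<omega>"
    unfolding return_time_def
  proof (rule Inf_greatest)
    fix t assume "t \<in> enat ` {t. 1 \<le> t \<and> \<omega> t \<in> A}"
    then show "enat (Suc n) \<le> t" using * by (auto simp: not_le Suc_le_eq)
  qed
  then show "enat n < return_time A \<omega>" by (simp add: Suc_ile_eq)
qed

context markov_kernel
begin

lemma nn_integral_path_markov:
  assumes z: "z \<in> space M" and B: "B \<in> sets (PiM {0..<Suc n} (\<lambda>_. M))" and u: "u \<in> borel_measurable M"
  shows "(\<integral>\<^sup>+\<omega>. indicator B (restrict \<omega> {0..<Suc n}) * u (\<omega> (Suc n)) \<partial>path_law M K z) =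
    (\<integral>\<^sup>+\<omega>. indicator B (restrict \<omega> {0..<Suc n}) * (\<integral>\<^sup>+y. u y \<partial>K (\<omega> n)) \<partial>path_law M K z)"
proof -
  let ?P = "path_law M K z"
  note s = sets_path_law[OF kernel z]
  have sp: "space ?P = space (PiM UNIV (\<lambda>_. M))" by (rule sets_eq_imp_space_eq[OF s])
  have c[measurable]: "(\<lambda>\<omega>. \<omega> i) \<in> ?P \<rightarrow>\<^sub>M M" for i
    unfolding measurable_cong_sets[OF s refl] by simp
  have r[measurable]: "(\<lambda>\<omega>. restrict \<omega> {0..<Suc n}) \<in> ?P \<rightarrow>\<^sub>M PiM {0..<Suc n} (\<lambda>_. M)"
    unfolding measurable_cong_sets[OF s refl] by (rule measurable_restrict_subset) simp
  have i[measurable]: "(\<lambda>\<omega>. indicator B (restrict \<omega> {0..<Suc n}) :: ennreal) \<in> borel_measurable ?P"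
    using r by (rule measurable_compose) (rule borel_measurable_indicator[OF B])
  have coord: "\<omega> i \<in> space M" if "\<omega> \<in> space ?P" for \<omega> i
    using that by (auto simp: sp space_PiM PiE_iff)
  have km: "(\<lambda>\<omega>. \<integral>\<^sup>+y. v y \<partial>K (\<omega> n)) \<in> borel_measurable ?P" if "v \<in> borel_measurable M" for v
    using c by (rule measurable_compose) (rule measurable_nn_integral_kernel[OF that])
  let ?I = "\<lambda>\<omega>. indicator B (restrict \<omega> {0..<Suc n}) :: ennreal"
  show ?thesis using u
  proof (induction rule: borel_measurable_induct)
    case (cong f g)
    have "(\<integral>\<^sup>+y. f y \<partial>K x) = (\<integral>\<^sup>+y. g y \<partial>K x)" if "x \<in> space M" for x
      by (rule nn_integral_cong) (simp add: space_kernel that cong(3))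
    then have "(\<integral>\<^sup>+\<omega>. ?I \<omega> * (\<integral>\<^sup>+y. f y \<partial>K (\<omega> n)) \<partial>?P) = (\<integral>\<^sup>+\<omega>. ?I \<omega> * (\<integral>\<^sup>+y. g y \<partial>K (\<omega> n)) \<partial>?P)"
      by (intro nn_integral_cong) (simp add: coord)
    moreover have "(\<integral>\<^sup>+\<omega>. ?I \<omega> * f (\<omega> (Suc n)) \<partial>?P) = (\<integral>\<^sup>+\<omega>. ?I \<omega> * g (\<omega> (Suc n)) \<partial>?P)"
      by (rule nn_integral_cong) (simp add: coord cong(3))
    ultimately show ?case by (simp only: cong(4))
  next
    case (set A)
    have S: "{\<omega>\<in>space ?P. restrict \<omega> {0..<Suc n} \<in> B \<and> \<omega> (Suc n) \<in> A} \<in> sets ?P"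
      using sets.Int[OF measurable_sets[OF r B] measurable_sets[OF c[of "Suc n"] set]]
      by (simp add: vimage_def Int_def conj_ac)
    have "(\<integral>\<^sup>+\<omega>. ?I \<omega> * indicator A (\<omega> (Suc n)) \<partial>?P) =
      emeasure ?P {\<omega>\<in>space ?P. restrict \<omega> {0..<Suc n} \<in> B \<and> \<omega> (Suc n) \<in> A}"
      unfolding nn_integral_indicator[OF S, symmetric]
      by (rule nn_integral_cong) (simp split: split_indicator)
    also have "\<dots> = (\<integral>\<^sup>+\<omega>. ?I \<omega> * emeasure (K (\<omega> n)) A \<partial>?P)"
      by (rule path_law_markov[OF kernel z set B])
    also have "\<dots> = (\<integral>\<^sup>+\<omega>. ?I \<omega> * (\<integral>\<^sup>+y. indicator A y \<partial>K (\<omega> n)) \<partial>?P)"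
      using set by (intro nn_integral_cong) (simp add: coord sets_kernel)
    finally show ?case .
  next
    case (mult u a)
    note [measurable] = mult(2) km[OF mult(2)]
    have "(\<integral>\<^sup>+y. a * u y \<partial>K x) = a * (\<integral>\<^sup>+y. u y \<partial>K x)" if "x \<in> space M" for x
      using mult(2) by (intro nn_integral_cmult) (simp add: measurable_kernel_iff that)
    then have "(\<integral>\<^sup>+\<omega>. ?I \<omega> * (\<integral>\<^sup>+y. a * u y \<partial>K (\<omega> n)) \<partial>?P) = (\<integral>\<^sup>+\<omega>. a * (?I \<omega> * (\<integral>\<^sup>+y. u y \<partial>K (\<omega> n))) \<partial>?P)"
      by (intro nn_integral_cong) (simp add: coord mult.left_commute)
    moreover have "(\<integral>\<^sup>+\<omega>. ?I \<omega> * (a * u (\<omega> (Suc n))) \<partial>?P) = (\<integral>\<^sup>+\<omega>. a * (?I \<omega> * u (\<omega> (Suc n))) \<partial>?P)"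
      by (rule nn_integral_cong) (simp add: mult.left_commute)
    moreover have "(\<integral>\<^sup>+\<omega>. a * (?I \<omega> * (\<integral>\<^sup>+y. u y \<partial>K (\<omega> n))) \<partial>?P) = a * (\<integral>\<^sup>+\<omega>. ?I \<omega> * (\<integral>\<^sup>+y. u y \<partial>K (\<omega> n)) \<partial>?P)"
      by (rule nn_integral_cmult) measurable
    moreover have "(\<integral>\<^sup>+\<omega>. a * (?I \<omega> * u (\<omega> (Suc n))) \<partial>?P) = a * (\<integral>\<^sup>+\<omega>. ?I \<omega> * u (\<omega> (Suc n)) \<partial>?P)"
      by (rule nn_integral_cmult) measurable
    ultimately show ?case by (simp only: mult(4))
  next
    case (add u v)
    note [measurable] = add(1,3) km[OF add(1)] km[OF add(3)]
    have "(\<integral>\<^sup>+y. v y + u y \<partial>K x) = (\<integral>\<^sup>+y. v y \<partial>K x) + (\<integral>\<^sup>+y. u y \<partial>K x)" if "x \<in> space M" for x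
      using add(1,3) by (intro nn_integral_add) (simp_all add: measurable_kernel_iff that)
    then have "(\<integral>\<^sup>+\<omega>. ?I \<omega> * (\<integral>\<^sup>+y. v y + u y \<partial>K (\<omega> n)) \<partial>?P) =
      (\<integral>\<^sup>+\<omega>. ?I \<omega> * (\<integral>\<^sup>+y. v y \<partial>K (\<omega> n)) + ?I \<omega> * (\<integral>\<^sup>+y. u y \<partial>K (\<omega> n)) \<partial>?P)"
      by (intro nn_integral_cong) (simp add: coord distrib_left)
    also have "\<dots> = (\<integral>\<^sup>+\<omega>. ?I \<omega> * (\<integral>\<^sup>+y. v y \<partial>K (\<omega> n)) \<partial>?P) + (\<integral>\<^sup>+\<omega>. ?I \<omega> * (\<integral>\<^sup>+y. u y \<partial>K (\<omega> n)) \<partial>?P)"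
      by (rule nn_integral_add) measurable
    also have "\<dots> = (\<integral>\<^sup>+\<omega>. ?I \<omega> * v (\<omega> (Suc n)) + ?I \<omega> * u (\<omega> (Suc n)) \<partial>?P)"
      unfolding add(6,7)[symmetric] by (rule nn_integral_add[symmetric]) measurable
    finally show ?case by (simp only: distrib_left)
  next
    case (seq U)
    note [measurable] = seq(1) km[OF seq(1)]
    have inc: "incseq (\<lambda>i. U i y)" for y using seq(3) by (auto simp: incseq_def le_fun_def)
    have inc': "incseq (\<lambda>i. \<integral>\<^sup>+y. U i y \<partial>K x)" for x
      using inc by (intro incseq_SucI nn_integral_mono) (auto simp: incseq_def)
    have "(\<integral>\<^sup>+y. (SUP i. U i y) \<partial>K x) = (SUP i. \<integral>\<^sup>+y. U i y \<partial>K x)" if "x \<in> space M" for x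
      using seq(1,3) by (intro nn_integral_monotone_convergence_SUP) (simp_all add: measurable_kernel_iff that)
    then have "(\<integral>\<^sup>+\<omega>. ?I \<omega> * (\<integral>\<^sup>+y. (SUP i. U i y) \<partial>K (\<omega> n)) \<partial>?P) =
      (\<integral>\<^sup>+\<omega>. (SUP i. ?I \<omega> * (\<integral>\<^sup>+y. U i y \<partial>K (\<omega> n))) \<partial>?P)"
      by (intro nn_integral_cong) (simp add: coord SUP_mult_left_ennreal)
    also have "\<dots> = (SUP i. \<integral>\<^sup>+\<omega>. ?I \<omega> * (\<integral>\<^sup>+y. U i y \<partial>K (\<omega> n)) \<partial>?P)"
      by (rule nn_integral_monotone_convergence_SUP)
         (use inc' in \<open>auto simp: incseq_def le_fun_def intro!: mult_left_mono\<close>)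
    also have "\<dots> = (SUP i. \<integral>\<^sup>+\<omega>. ?I \<omega> * U i (\<omega> (Suc n)) \<partial>?P)"
      by (simp only: seq.IH)
    also have "\<dots> = (\<integral>\<^sup>+\<omega>. (SUP i. ?I \<omega> * U i (\<omega> (Suc n))) \<partial>?P)"
      by (rule nn_integral_monotone_convergence_SUP[symmetric])
         (use inc in \<open>auto simp: incseq_def le_fun_def intro!: mult_left_mono\<close>)
    also have "\<dots> = (\<integral>\<^sup>+\<omega>. ?I \<omega> * (SUP i. U i (\<omega> (Suc n))) \<partial>?P)"
      by (simp only: SUP_mult_left_ennreal)
    finally show ?case unfolding SUP_apply by (rule sym)
  qed
qed

text \<open>The bridge from paths to operators. Conditioning on the times up to \<open>n\<close>
  replaces \<open>u\<close> at time \<open>Suc n\<close> by \<open>step_in K C u\<close> at time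
  \<open>n\<close>; hence the induction generalizes over \<open>u\<close>.\<close>

lemma nn_integral_path_taboo:
  assumes z: "z \<in> space M" and C: "C \<in> sets M" and u: "u \<in> borel_measurable M"
  shows "(\<integral>\<^sup>+\<omega>. indicator {\<omega>. \<forall>i\<in>{1..n}. \<omega> i \<in> C} \<omega> * u (\<omega> n) \<partial>path_law M K z) = (step_in K C ^^ n) u z"
  using u
proof (induction n arbitrary: u)
  case 0
  have s: "sets (path_law M K z) = sets (PiM UNIV (\<lambda>_. M))" by (rule sets_path_law[OF kernel z])
  have "(\<integral>\<^sup>+\<omega>. u (\<omega> 0) \<partial>path_law M K z) = (\<integral>\<^sup>+y. u y \<partial>distr (path_law M K z) M (\<lambda>\<omega>. \<omega> 0))"
    using 0 by (subst nn_integral_distr) (simp_all add: measurable_cong_sets[OF s refl])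
  also have "\<dots> = u z" unfolding path_law_start[OF kernel z] using z 0 by (simp add: nn_integral_return)
  finally show ?case by simp
next
  case (Suc n)
  interpret positive_operator M C "step_in K C" by (rule positive_operator_step_in[OF C])
  let ?B = "{\<omega> \<in> space (PiM {0..<Suc n} (\<lambda>_. M)). \<forall>i\<in>{1..n}. \<omega> i \<in> C}"
  have sp: "space (path_law M K z) = space (PiM UNIV (\<lambda>_. M))"
    by (rule sets_eq_imp_space_eq[OF sets_path_law[OF kernel z]])
  have B: "?B \<in> sets (PiM {0..<Suc n} (\<lambda>_. M))"
  proof (rule sets.sets_Collect_finite_All)
    fix i assume "i \<in> {1..n}"
    then have c: "(\<lambda>\<omega>. \<omega> i) \<in> PiM {0..<Suc n} (\<lambda>_. M) \<rightarrow>\<^sub>M M"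
      by (intro measurable_component_singleton) auto
    show "{\<omega> \<in> space (PiM {0..<Suc n} (\<lambda>_. M)). \<omega> i \<in> C} \<in> sets (PiM {0..<Suc n} (\<lambda>_. M))"
      using measurable_sets[OF c C] by (simp only: vimage_def Int_def mem_Collect_eq conj_commute)
  qed simp
  have iB: "indicator ?B (restrict \<omega> {0..<Suc n}) = (indicator {\<omega>. \<forall>i\<in>{1..n}. \<omega> i \<in> C} \<omega> :: ennreal)"
    if "\<omega> \<in> space (path_law M K z)" for \<omega>
  proof -
    have "restrict \<omega> {0..<Suc n} \<in> space (PiM {0..<Suc n} (\<lambda>_. M))"
      using that by (simp add: sp space_PiM PiE_iff)
    then show ?thesis by (simp add: indicator_def)
  qed
  have iS: "indicator {\<omega>. \<forall>i\<in>{1..Suc n}. \<omega> i \<in> C} \<omega> =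
      (indicator {\<omega>. \<forall>i\<in>{1..n}. \<omega> i \<in> C} \<omega> * indicator C (\<omega> (Suc n)) :: ennreal)" for \<omega>
  proof -
    have "(\<forall>i\<in>{1..Suc n}. \<omega> i \<in> C) \<longleftrightarrow> (\<forall>i\<in>{1..n}. \<omega> i \<in> C) \<and> \<omega> (Suc n) \<in> C"
      by (simp add: atLeastAtMostSuc_conv conj_commute)
    then show ?thesis by (simp add: indicator_def)
  qed
  have m: "(\<lambda>y. indicator C y * u y) \<in> borel_measurable M"
    using C Suc(2) by measurable
  have "(\<integral>\<^sup>+\<omega>. indicator {\<omega>. \<forall>i\<in>{1..Suc n}. \<omega> i \<in> C} \<omega> * u (\<omega> (Suc n)) \<partial>path_law M K z) =
    (\<integral>\<^sup>+\<omega>. indicator ?B (restrict \<omega> {0..<Suc n}) * (indicator C (\<omega> (Suc n)) * u (\<omega> (Suc n))) \<partial>path_law M K z)"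
    by (intro nn_integral_cong) (simp only: iS iB mult.assoc)
  also have "\<dots> = (\<integral>\<^sup>+\<omega>. indicator ?B (restrict \<omega> {0..<Suc n}) * step_in K C u (\<omega> n) \<partial>path_law M K z)"
    unfolding step_in_def by (rule nn_integral_path_markov[OF z B m])
  also have "\<dots> = (\<integral>\<^sup>+\<omega>. indicator {\<omega>. \<forall>i\<in>{1..n}. \<omega> i \<in> C} \<omega> * step_in K C u (\<omega> n) \<partial>path_law M K z)"
    by (intro nn_integral_cong) (simp only: iB)
  also have "\<dots> = (step_in K C ^^ Suc n) u z"
    unfolding funpow_Suc_right comp_def by (rule Suc.IH[OF measurable_op[OF Suc.prems]])
  finally show ?case .
qed

lemma measurable_path_coord:
  "z \<in> space M \<Longrightarrow> (\<lambda>\<omega>. \<omega> i) \<in> path_law M K z \<rightarrow>\<^sub>M M"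
  by (simp add: measurable_cong_sets[OF sets_path_law[OF kernel] refl])

lemma sets_less_return_time:
  assumes z: "z \<in> space M" and A: "A \<in> sets M"
  shows "{\<omega> \<in> space (path_law M K z). enat n < return_time A \<omega>} \<in> sets (path_law M K z)"
proof -
  have "{\<omega> \<in> space (path_law M K z). \<omega> i \<notin> A} = (\<lambda>\<omega>. \<omega> i) -` (space M - A) \<inter> space (path_law M K z)" for i
    using measurable_space[OF measurable_path_coord[OF z]] by blast
  then have "{\<omega> \<in> space (path_law M K z). \<omega> i \<notin> A} \<in> sets (path_law M K z)" for i
    using measurable_sets[OF measurable_path_coord[OF z] sets.compl_sets[OF A]] by simp
  then show ?thesis
    unfolding less_return_time_iff by (intro sets.sets_Collect_finite_All) auto
qed

lemma emeasure_less_return_time: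
  assumes z: "z \<in> space M" and A: "A \<in> sets M"
  shows "emeasure (path_law M K z) {\<omega> \<in> space (path_law M K z). enat n < return_time A \<omega>} =
    (step_in K (space M - A) ^^ n) (\<lambda>_. 1) z"
proof -
  have "emeasure (path_law M K z) {\<omega> \<in> space (path_law M K z). enat n < return_time A \<omega>} =
    (\<integral>\<^sup>+\<omega>. indicator {\<omega>. \<forall>i\<in>{1..n}. \<omega> i \<in> space M - A} \<omega> * 1 \<partial>path_law M K z)"
    unfolding nn_integral_indicator[OF sets_less_return_time[OF z A], symmetric]
    using measurable_space[OF measurable_path_coord[OF z]]
    by (intro nn_integral_cong) (auto simp: less_return_time_iff split: split_indicator)
  also have "\<dots> = (step_in K (space M - A) ^^ n) (\<lambda>_. 1) z"
    by (rule nn_integral_path_taboo) (use z A in auto)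
  finally show ?thesis .
qed

lemma nn_integral_return_time:
  assumes z: "z \<in> space M" and A: "A \<in> sets M"
  shows "(\<integral>\<^sup>+\<omega>. ennreal_of_enat (return_time A \<omega>) \<partial>path_law M K z) = excursion M K A (\<lambda>_. 1) z"
proof -
  let ?P = "path_law M K z"
  let ?E = "\<lambda>n. {\<omega> \<in> space ?P. enat n < return_time A \<omega>}"
  have "(\<integral>\<^sup>+\<omega>. ennreal_of_enat (return_time A \<omega>) \<partial>?P) = (\<integral>\<^sup>+\<omega>. (\<Sum>n. indicator (?E n) \<omega>) \<partial>?P)"
    unfolding ennreal_of_enat_eq_suminf
    by (intro nn_integral_cong arg_cong[where f=suminf]) (auto simp: fun_eq_iff)
  also have "\<dots> = (\<Sum>n. \<integral>\<^sup>+\<omega>. indicator (?E n) \<omega> \<partial>?P)"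
    using sets_less_return_time[OF z A] by (intro nn_integral_suminf) auto
  also have "\<dots> = (\<Sum>n. emeasure ?P (?E n))"
    using sets_less_return_time[OF z A] by simp
  finally show ?thesis
    by (simp add: excursion_def emeasure_less_return_time[OF z A])
qed

text \<open>Never returning is the decreasing intersection of the events of no return by time
  \<open>n\<close>; continuity from above turns its probability into the infimum.\<close>

lemma AE_return_time_finite_iff:
  assumes z: "z \<in> space M" and A: "A \<in> sets M"
  shows "(AE \<omega> in path_law M K z. return_time A \<omega> < \<infinity>) \<longleftrightarrow>
    (INF n. (step_in K (space M - A) ^^ n) (\<lambda>_. 1) z) = 0"
proof -
  let ?P = "path_law M K z"
  let ?E = "\<lambda>n. {\<omega> \<in> space ?P. enat n < return_time A \<omega>}"
  interpret P: prob_space ?P by (rule prob_space_path_law[OF kernel z])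
  have E: "?E n \<in> sets ?P" for n by (rule sets_less_return_time[OF z A])
  have eq: "{\<omega> \<in> space ?P. \<not> return_time A \<omega> < \<infinity>} = (\<Inter>n. ?E n)"
  proof -
    have "r < \<infinity> \<longleftrightarrow> (\<exists>n. r \<le> enat n)" for r :: enat
      by (cases r) auto
    then show ?thesis by (auto simp: not_le)
  qed
  have "(AE \<omega> in ?P. return_time A \<omega> < \<infinity>) \<longleftrightarrow> emeasure ?P (\<Inter>n. ?E n) = 0"
    by (subst AE_iff_measurable[OF _ eq]) (auto intro: E)
  also have "emeasure ?P (\<Inter>n. ?E n) = (INF n. emeasure ?P (?E n))"
  proof (rule INF_emeasure_decseq[symmetric])
    show "decseq ?E"
      by (rule decseq_SucI) (auto simp: less_return_time_iff)
  qed (auto intro: E)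
  finally show ?thesis by (simp only: emeasure_less_return_time[OF z A])
qed

text \<open>From here on recurrence is a statement about powers of a taboo step, and the path space
  serves only to translate the hypotheses.\<close>

lemma positive_recurrent_iff:
  "positive_recurrent M K A \<longleftrightarrow> A \<in> sets M \<and>
    (\<forall>z\<in>space M. (INF n. (step_in K (space M - A) ^^ n) (\<lambda>_. 1) z) = 0) \<and>
    (SUP z\<in>A. excursion M K A (\<lambda>_. 1) z) < \<infinity>"
proof (cases "A \<in> sets M")
  case True
  then have "z \<in> A \<Longrightarrow> z \<in> space M" for z using sets.sets_into_space by blast
  then have "(SUP z\<in>A. \<integral>\<^sup>+\<omega>. ennreal_of_enat (return_time A \<omega>) \<partial>path_law M K z) =
      (SUP z\<in>A. excursion M K A (\<lambda>_. 1) z)"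
    by (intro SUP_cong refl nn_integral_return_time[OF _ True]) auto
  moreover have "(\<forall>z\<in>space M. AE \<omega> in path_law M K z. return_time A \<omega> < \<infinity>) \<longleftrightarrow>
      (\<forall>z\<in>space M. (INF n. (step_in K (space M - A) ^^ n) (\<lambda>_. 1) z) = 0)"
    using AE_return_time_finite_iff[OF _ True] by blast
  ultimately show ?thesis
    unfolding positive_recurrent_def by (simp only:)
qed (simp add: positive_recurrent_def)

lemma distr_path_law_1:
  assumes z: "z \<in> space M"
  shows "distr (path_law M K z) M (\<lambda>\<omega>. \<omega> 1) = K z"
proof (rule measure_eqI)
  fix A assume "A \<in> sets (distr (path_law M K z) M (\<lambda>\<omega>. \<omega> 1))"
  then have A: "A \<in> sets M" by simp
  \<comment> \<open>Requiring time 1 to lie in \<open>space M\<close> excludes nothing; it gives the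
    integral the form of \<open>nn_integral_path_taboo\<close>.\<close>
  have "emeasure (distr (path_law M K z) M (\<lambda>\<omega>. \<omega> 1)) A =
    (\<integral>\<^sup>+\<omega>. indicator {\<omega>. \<forall>i\<in>{1..1}. \<omega> i \<in> space M} \<omega> * indicator A (\<omega> 1) \<partial>path_law M K z)"
    using A measurable_path_coord[OF z, of 1]
    by (subst nn_integral_indicator[symmetric], simp, subst nn_integral_distr)
       (auto intro!: nn_integral_cong dest: measurable_space split: split_indicator)
  also have "\<dots> = emeasure (K z) A"
    using A z by (subst nn_integral_path_taboo) (simp_all add: step_in_space sets_kernel)
  finally show "emeasure (distr (path_law M K z) M (\<lambda>\<omega>. \<omega> 1)) A = emeasure (K z) A" .
qed (simp add: sets_kernel z)

text \<open>Stated through a real function because the singleton of \<open>z\<close> need not be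
  measurable.\<close>

lemma AE_path_law_start:
  assumes z: "z \<in> space M" and f: "f \<in> M \<rightarrow>\<^sub>M (borel :: real measure)"
  shows "AE \<omega> in path_law M K z. f (\<omega> 0) = f z"
proof -
  have "AE y in distr (path_law M K z) M (\<lambda>\<omega>. \<omega> 0). f y = f z"
  proof -
    have "Measurable.pred M (\<lambda>y. f y = f z)"
      using f by measurable
    from AE_return[OF z this] show ?thesis unfolding path_law_start[OF kernel z] by simp
  qed
  then show ?thesis
    by (rule AE_distrD[OF measurable_path_coord[OF z]])
qed

end

section \<open>Excursions\<close>

lemma (in markov_kernel) step_in_cong:
  "x \<in> space M \<Longrightarrow> (\<And>y. y \<in> space M \<Longrightarrow> indicator C y * u y = indicator C' y * (v y :: ennreal)) \<Longrightarrow>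
    step_in K C u x = step_in K C' v x"
  unfolding step_in_def by (rule nn_integral_cong) (simp add: space_kernel)

locale markov_set = markov_kernel +
  fixes V :: "'a set"
  assumes V: "V \<in> sets M"
begin

abbreviation avoid :: "('a \<Rightarrow> ennreal) \<Rightarrow> 'a \<Rightarrow> ennreal" where
  "avoid \<equiv> step_in K (space M - V)"

abbreviation hit :: "('a \<Rightarrow> ennreal) \<Rightarrow> 'a \<Rightarrow> ennreal" where
  "hit \<equiv> step_in K V"

abbreviation exc :: "('a \<Rightarrow> ennreal) \<Rightarrow> 'a \<Rightarrow> ennreal" where
  "exc \<equiv> excursion M K V"

abbreviation ret :: "('a \<Rightarrow> ennreal) \<Rightarrow> 'a \<Rightarrow> ennreal" where
  "ret \<equiv> return_op M K V"

lemma V_subset: "V \<subseteq> space M"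
  by (rule sets.sets_into_space[OF V])

sublocale avoid: positive_operator M "space M - V" avoid
  by (rule positive_operator_step_in[OF sets.compl_sets[OF V]])

sublocale hit: positive_operator M V hit
  by (rule positive_operator_step_in[OF V])

lemma positive_operator_avoid_pow: "positive_operator M (space M) (avoid ^^ n)"
  by (rule positive_operator_funpow[OF avoid.positive_operator_axioms]) auto

lemma positive_operator_exc: "positive_operator M (space M) exc"
  unfolding excursion_def[abs_def]
  by (rule positive_operator_suminf) (rule positive_operator_avoid_pow)

sublocale exc: positive_operator M "space M" exc
  by (rule positive_operator_exc)

lemma positive_operator_ret: "positive_operator M V ret"
  unfolding return_op_def[abs_def]
  by (rule positive_operator_comp[OF positive_operator_exc hit.positive_operator_axioms]) simp

sublocale ret: positive_operator M V ret
  by (rule positive_operator_ret)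

text \<open>First-step decomposition: the term for time 0 splits off, and \<open>avoid\<close>
  factors out of the remaining series by monotone convergence.\<close>

lemma exc_eq:
  assumes u: "u \<in> borel_measurable M" and x: "x \<in> space M"
  shows "exc u x = u x + avoid (exc u) x"
proof -
  have "avoid (exc u) x = (\<Sum>n. avoid ((avoid ^^ n) u) x)"
    unfolding excursion_def[abs_def]
    by (rule step_in_suminf) (use V u x positive_operator.measurable_op[OF positive_operator_avoid_pow] in auto)
  moreover have "exc u x = (avoid ^^ 0) u x + (\<Sum>n. (avoid ^^ Suc n) u x)"
    unfolding excursion_def using suminf_offset[of "\<lambda>n. (avoid ^^ n) u x" 1]
    by (simp add: add.commute)
  ultimately show ?thesis by simp
qed

lemma ret_eq:
  "u \<in> borel_measurable M \<Longrightarrow> x \<in> space M \<Longrightarrow> ret u x = hit u x + avoid (ret u) x"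
  unfolding return_op_def by (rule exc_eq) (auto intro: hit.measurable_op)

text \<open>Apply the powers of \<open>avoid\<close> to the hypothesis and chain the results. The
  residual \<open>(avoid ^^ n) W\<close> is carried along on the left, as nothing can be cancelled
  in \<open>ennreal\<close>, and is dropped only before the limit.\<close>

lemma exc_add_le:
  assumes a: "a \<in> borel_measurable M" and b: "b \<in> borel_measurable M" and W: "W \<in> borel_measurable M"
    and le: "\<And>x. x \<in> space M \<Longrightarrow> a x + avoid W x \<le> W x + b x" and x: "x \<in> space M"
  shows "exc a x \<le> W x + exc b x"
proof -
  have "(\<Sum>k<n. (avoid ^^ k) a x) + (avoid ^^ n) W x \<le> W x + (\<Sum>k<n. (avoid ^^ k) b x)" for n
  proof (induction n)
    case (Suc n)
    interpret positive_operator M "space M" "avoid ^^ n" by (rule positive_operator_avoid_pow)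
    have "(avoid ^^ n) a x + (avoid ^^ Suc n) W x = (avoid ^^ n) (\<lambda>x. a x + avoid W x) x"
      using add[OF a avoid.measurable_op[OF W] x] by (simp add: funpow_swap1)
    also have "\<dots> \<le> (avoid ^^ n) (\<lambda>x. W x + b x) x"
      by (rule mono) (auto intro: le x)
    also have "\<dots> = (avoid ^^ n) W x + (avoid ^^ n) b x" by (rule add[OF W b x])
    finally have *: "(avoid ^^ n) a x + (avoid ^^ Suc n) W x \<le> (avoid ^^ n) W x + (avoid ^^ n) b x" .
    have "(\<Sum>k<Suc n. (avoid ^^ k) a x) + (avoid ^^ Suc n) W x =
        (\<Sum>k<n. (avoid ^^ k) a x) + ((avoid ^^ n) a x + (avoid ^^ Suc n) W x)"
      by (simp add: add.assoc)
    also have "\<dots> \<le> (\<Sum>k<n. (avoid ^^ k) a x) + ((avoid ^^ n) W x + (avoid ^^ n) b x)"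
      by (intro add_left_mono *)
    also have "\<dots> \<le> W x + (\<Sum>k<n. (avoid ^^ k) b x) + (avoid ^^ n) b x"
      unfolding add.assoc[symmetric] by (intro add_right_mono Suc)
    finally show ?case by (simp add: add.assoc)
  qed simp
  then have "(\<Sum>k<n. (avoid ^^ k) a x) \<le> W x + (\<Sum>k<n. (avoid ^^ k) b x)" for n
    by (rule order_trans[rotated]) simp
  moreover have "(\<Sum>k<n. (avoid ^^ k) b x) \<le> exc b x" for n
    unfolding excursion_def by (rule sum_le_suminf) auto
  ultimately have "(\<Sum>k<n. (avoid ^^ k) a x) \<le> W x + exc b x" for n
    by (meson add_left_mono order_trans)
  then show ?thesis
    unfolding excursion_def[of M K V a] by (intro suminf_le_const) auto
qed

text \<open>Optional stopping at the return to \<open>V\<close> in operator form: the part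
  \<open>hit W\<close> of a full step counts as a running term next to \<open>a\<close>, and summing
  it over the excursion produces \<open>ret W\<close>.\<close>

lemma excursion_inequality:
  assumes a: "a \<in> borel_measurable M" and b: "b \<in> borel_measurable M" and W: "W \<in> borel_measurable M"
    and le: "\<And>x. x \<in> space M \<Longrightarrow> (\<integral>\<^sup>+y. W y \<partial>K x) + a x \<le> W x + b x" and x: "x \<in> space M"
  shows "ret W x + exc a x \<le> W x + exc b x"
proof -
  have "exc (\<lambda>x. hit W x + a x) x \<le> W x + exc b x"
  proof (rule exc_add_le[OF _ b W _ x])
    fix x assume x: "x \<in> space M"
    show "hit W x + a x + avoid W x \<le> W x + b x"
      using le[OF x] unfolding step_in_split[OF V W x, symmetric] by (simp add: ac_simps)
  qed (use a hit.measurable_op[OF W] in simp)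
  then show ?thesis
    unfolding return_op_def by (subst (asm) exc.add[OF hit.measurable_op[OF W] a x])
qed

lemma avoid_pow_decseq: "x \<in> space M \<Longrightarrow> decseq (\<lambda>n. (avoid ^^ n) (\<lambda>_. 1) x)"
  by (rule funpow_step_in_decseq[OF sets.compl_sets[OF V]])

text \<open>At every time the mass that has returned and the mass still avoiding \<open>V\<close>
  add up to 1; the latter vanishes in the limit.\<close>

lemma ret_1:
  assumes x: "x \<in> space M" and inf: "(INF n. (avoid ^^ n) (\<lambda>_. 1) x) = 0"
  shows "ret (\<lambda>_. 1) x = 1"
proof -
  let ?s = "\<lambda>n. \<Sum>k<n. (avoid ^^ k) (hit (\<lambda>_. 1)) x"
  have eq: "?s n + (avoid ^^ n) (\<lambda>_. 1) x = 1" for n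
  proof (induction n)
    case (Suc n)
    interpret positive_operator M "space M" "avoid ^^ n" by (rule positive_operator_avoid_pow)
    have "(avoid ^^ n) (hit (\<lambda>_. 1)) x + (avoid ^^ Suc n) (\<lambda>_. 1) x =
        (avoid ^^ n) (\<lambda>x. hit (\<lambda>_. 1) x + avoid (\<lambda>_. 1) x) x"
      by (subst add) (auto simp: funpow_swap1 x intro: hit.measurable_op avoid.measurable_op)
    also have "\<dots> = (avoid ^^ n) (\<lambda>_. 1) x"
      using step_in_split[OF V, of "\<lambda>_. 1"] prob_space.emeasure_space_1[OF prob_space_kernel]
      by (intro cong x) auto
    finally show ?case using Suc by (simp add: add.assoc del: funpow.simps)
  qed simp
  have "?s \<longlonglongrightarrow> ret (\<lambda>_. 1) x"
    unfolding return_op_def excursion_def by (rule summable_LIMSEQ) auto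
  moreover have "(\<lambda>n. (avoid ^^ n) (\<lambda>_. 1) x) \<longlonglongrightarrow> 0"
    using LIMSEQ_INF[OF avoid_pow_decseq[OF x]] inf by simp
  ultimately have "(\<lambda>n. ?s n + (avoid ^^ n) (\<lambda>_. 1) x) \<longlonglongrightarrow> ret (\<lambda>_. 1) x + 0"
    by (rule tendsto_add)
  then show ?thesis
    unfolding eq by (simp add: LIMSEQ_const_iff)
qed

text \<open>The next visit after time 1 is the first return if the first step misses
  \<open>V\<close>, and the second return if that step hits \<open>V\<close>. This carries a lower
  bound at a fixed time, as in (A3), over to the chain watched on \<open>V\<close>.\<close>

lemma step_ret_le:
  assumes u: "u \<in> borel_measurable M" and x: "x \<in> space M"
  shows "step_in K (space M) (ret u) x \<le> ret (ret u) x + ret u x"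
proof -
  have m: "ret u \<in> borel_measurable M" by (rule ret.measurable_op[OF u])
  have "step_in K (space M) (ret u) x = hit (ret u) x + avoid (ret u) x"
    by (simp add: step_in_space x step_in_split[OF V m])
  also have "\<dots> \<le> ret (ret u) x + ret u x"
    unfolding ret_eq[OF m x] ret_eq[OF u x] by (intro add_mono) auto
  finally show ?thesis .
qed

text \<open>The next visit after time \<open>m\<close> is one of the first \<open>Suc m\<close>
  returns. Bounding the two cases of \<open>step_ret_le\<close> separately doubles the sum at each
  step, which is harmless because later only positivity of the constant matters.\<close>

lemma step_pow_ret_le:
  assumes u: "u \<in> borel_measurable M" and x: "x \<in> space M"
  shows "(step_in K (space M) ^^ m) (ret u) x \<le> 2 ^ m * (\<Sum>j<Suc m. (ret ^^ Suc j) u x)"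
  using x
proof (induction m arbitrary: x)
  case (Suc m)
  let ?P = "step_in K (space M)"
  interpret P: positive_operator M "space M" ?P by (rule positive_operator_step_in) simp
  have m: "(ret ^^ j) u \<in> borel_measurable M" for j
    by (induction j) (auto intro: u ret.measurable_op)
  have "(?P ^^ Suc m) (ret u) x \<le> ?P (\<lambda>x. 2 ^ m * (\<Sum>j<Suc m. (ret ^^ Suc j) u x)) x"
    unfolding funpow.simps comp_def by (rule P.mono) (use Suc in auto)
  also have "\<dots> = 2 ^ m * (\<Sum>j<Suc m. ?P ((ret ^^ Suc j) u) x)"
    by (subst P.cmult, intro borel_measurable_sum m, fact, subst P.sum) (intro m Suc.prems refl)+
  also have "\<dots> \<le> 2 ^ m * (\<Sum>j<Suc m. (ret ^^ Suc (Suc j)) u x + (ret ^^ Suc j) u x)"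
    using step_ret_le[OF m Suc.prems] by (intro mult_left_mono sum_mono) auto
  also have "\<dots> \<le> 2 ^ m * (2 * (\<Sum>j<Suc (Suc m). (ret ^^ Suc j) u x))"
  proof (rule mult_left_mono)
    have "(\<Sum>j<Suc m. (ret ^^ Suc (Suc j)) u x) \<le> (\<Sum>j<Suc (Suc m). (ret ^^ Suc j) u x)"
      unfolding sum.lessThan_Suc_shift[of _ "Suc m"] by (simp add: add_increasing)
    moreover have "(\<Sum>j<Suc m. (ret ^^ Suc j) u x) \<le> (\<Sum>j<Suc (Suc m). (ret ^^ Suc j) u x)"
      by (intro sum_mono2) auto
    ultimately show "(\<Sum>j<Suc m. (ret ^^ Suc (Suc j)) u x + (ret ^^ Suc j) u x) \<le> 2 * (\<Sum>j<Suc (Suc m). (ret ^^ Suc j) u x)"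
      unfolding sum.distrib mult_2 by (rule add_mono)
  qed simp
  finally show ?case by (simp only: power_Suc2 mult.assoc)
qed simp

section \<open>Excursions under the stationary law\<close>

lemma tendsto_nn_integral_avoid_pow:
  assumes \<pi>: "prob_space \<pi>" and s: "sets \<pi> = sets M"
    and rec: "\<And>x. x \<in> space M \<Longrightarrow> (INF n. (avoid ^^ n) (\<lambda>_. 1) x) = 0"
    and u: "u \<in> borel_measurable M" and bound: "\<And>x. x \<in> space M \<Longrightarrow> u x \<le> ennreal c"
  shows "(\<lambda>n. \<integral>\<^sup>+x. (avoid ^^ n) u x \<partial>\<pi>) \<longlonglongrightarrow> 0"
proof -
  interpret \<pi>: prob_space \<pi> by (rule \<pi>)
  have sp: "space \<pi> = space M" by (rule sets_eq_imp_space_eq[OF s])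
  note mc = measurable_cong_sets[OF s refl]
  have m: "(avoid ^^ n) v \<in> borel_measurable M" if "v \<in> borel_measurable M" for n v
    using positive_operator.measurable_op[OF positive_operator_avoid_pow that] .
  have "(\<lambda>n. \<integral>\<^sup>+x. (avoid ^^ n) u x \<partial>\<pi>) \<longlonglongrightarrow> (\<integral>\<^sup>+x. 0 \<partial>\<pi>)"
  proof (rule nn_integral_dominated_convergence[where w="\<lambda>_. ennreal c"])
    have le: "(avoid ^^ n) u x \<le> ennreal c * (avoid ^^ n) (\<lambda>_. 1) x" if x: "x \<in> space M" for n x
    proof -
      interpret positive_operator M "space M" "avoid ^^ n" by (rule positive_operator_avoid_pow)
      show ?thesis using mono[of u "\<lambda>_. ennreal c", OF bound x] const[OF x, of "ennreal c"] by simp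
    qed
    have lim: "(\<lambda>n. (avoid ^^ n) (\<lambda>_. 1) x) \<longlonglongrightarrow> 0" if x: "x \<in> space M" for x
      using LIMSEQ_INF[OF avoid_pow_decseq[OF x]] rec[OF x] by simp
    have le1: "(avoid ^^ n) (\<lambda>_. 1) x \<le> 1" if x: "x \<in> space M" for n x
      using decseqD[OF avoid_pow_decseq[OF x], of 0 n] by simp
    show "AE x in \<pi>. (avoid ^^ n) u x \<le> ennreal c" for n
    proof (rule AE_I2)
      fix x assume "x \<in> space \<pi>"
      then have x: "x \<in> space M" by (simp add: sp)
      show "(avoid ^^ n) u x \<le> ennreal c"
        using le[OF x, of n] mult_left_mono[OF le1[OF x, of n], of "ennreal c"] by simp
    qed
    show "AE x in \<pi>. (\<lambda>n. (avoid ^^ n) u x) \<longlonglongrightarrow> 0"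
    proof (rule AE_I2)
      fix x assume "x \<in> space \<pi>"
      then have x: "x \<in> space M" by (simp add: sp)
      have "(\<lambda>n. ennreal c * (avoid ^^ n) (\<lambda>_. 1) x) \<longlonglongrightarrow> ennreal c * 0"
        by (rule ennreal_tendsto_cmult[OF _ lim[OF x]]) simp
      then have "(\<lambda>n. ennreal c * (avoid ^^ n) (\<lambda>_. 1) x) \<longlonglongrightarrow> 0" by simp
      then show "(\<lambda>n. (avoid ^^ n) u x) \<longlonglongrightarrow> 0"
        by (rule tendsto_sandwich[OF _ _ tendsto_const, rotated 2]) (auto simp: le x)
    qed
  qed (use u m in \<open>auto simp: mc \<pi>.emeasure_space_1\<close>)
  then show ?thesis by simp
qed

text \<open>Split an integral at \<open>V\<close>; by stationarity the part off \<open>V\<close> is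
  the integral of \<open>avoid v\<close>. Iterating peels off the terms of \<open>exc u\<close> over
  \<open>V\<close> one by one, and boundedness of \<open>u\<close> makes the remainder
  vanish.\<close>

lemma kac_formula:
  assumes st: "stationary_distribution M K \<pi>"
    and rec: "\<And>x. x \<in> space M \<Longrightarrow> (INF n. (avoid ^^ n) (\<lambda>_. 1) x) = 0"
    and u: "u \<in> borel_measurable M" and bound: "\<And>x. x \<in> space M \<Longrightarrow> u x \<le> ennreal c"
  shows "(\<integral>\<^sup>+x. indicator V x * exc u x \<partial>\<pi>) = (\<integral>\<^sup>+x. u x \<partial>\<pi>)"
proof -
  have s: "sets \<pi> = sets M" and "prob_space \<pi>" and b: "\<pi> \<bind> K = \<pi>"
    using st by (auto simp: stationary_distribution_def space_prob_algebra)
  interpret \<pi>: prob_space \<pi> by fact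
  have sp: "space \<pi> = space M" by (rule sets_eq_imp_space_eq[OF s])
  note mc = measurable_cong_sets[OF s refl]
  have m: "(avoid ^^ n) v \<in> borel_measurable M" if "v \<in> borel_measurable M" for n v
    using positive_operator.measurable_op[OF positive_operator_avoid_pow that] .
  have st': "(\<integral>\<^sup>+x. v x \<partial>\<pi>) = (\<integral>\<^sup>+x. indicator V x * v x \<partial>\<pi>) + (\<integral>\<^sup>+x. avoid v x \<partial>\<pi>)"
    if v: "v \<in> borel_measurable M" for v
  proof -
    have i: "(\<lambda>x. indicator V x * v x) \<in> borel_measurable M" "(\<lambda>x. indicator (space M - V) x * v x) \<in> borel_measurable M"
      using V v by measurable
    have "(\<integral>\<^sup>+x. v x \<partial>\<pi>) = (\<integral>\<^sup>+x. indicator V x * v x + indicator (space M - V) x * v x \<partial>\<pi>)"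
      by (rule nn_integral_cong) (auto simp: sp split: split_indicator)
    also have "\<dots> = (\<integral>\<^sup>+x. indicator V x * v x \<partial>\<pi>) + (\<integral>\<^sup>+x. indicator (space M - V) x * v x \<partial>\<pi>)"
      using i by (intro nn_integral_add) (simp_all add: mc)
    also have "(\<integral>\<^sup>+x. indicator (space M - V) x * v x \<partial>\<pi>) = (\<integral>\<^sup>+x. avoid v x \<partial>\<pi>)"
      unfolding step_in_def
      by (subst (1) b[symmetric], rule nn_integral_bind[OF i(2)])
         (simp add: mc measurable_prob_algebraD[OF kernel])
    finally show ?thesis .
  qed
  have split: "(\<integral>\<^sup>+x. u x \<partial>\<pi>) = (\<Sum>k<n. \<integral>\<^sup>+x. indicator V x * (avoid ^^ k) u x \<partial>\<pi>) + (\<integral>\<^sup>+x. (avoid ^^ n) u x \<partial>\<pi>)" for n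
  proof (induction n)
    case (Suc n)
    then show ?case using st'[OF m[OF u, of n]] by (simp add: add.assoc)
  qed simp
  have lim1: "(\<lambda>n. \<Sum>k<n. \<integral>\<^sup>+x. indicator V x * (avoid ^^ k) u x \<partial>\<pi>) \<longlonglongrightarrow> (\<Sum>k. \<integral>\<^sup>+x. indicator V x * (avoid ^^ k) u x \<partial>\<pi>)"
    by (rule summable_LIMSEQ) auto
  have lim2: "(\<lambda>n. \<integral>\<^sup>+x. (avoid ^^ n) u x \<partial>\<pi>) \<longlonglongrightarrow> 0"
    by (rule tendsto_nn_integral_avoid_pow[OF \<pi>.prob_space_axioms s rec u bound])
  have "(\<lambda>n. \<integral>\<^sup>+x. u x \<partial>\<pi>) \<longlonglongrightarrow> (\<Sum>k. \<integral>\<^sup>+x. indicator V x * (avoid ^^ k) u x \<partial>\<pi>) + 0"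
    using tendsto_add[OF lim1 lim2] by (simp only: split[symmetric])
  then have "(\<integral>\<^sup>+x. u x \<partial>\<pi>) = (\<Sum>k. \<integral>\<^sup>+x. indicator V x * (avoid ^^ k) u x \<partial>\<pi>)"
    by (simp add: LIMSEQ_const_iff)
  also have "\<dots> = (\<integral>\<^sup>+x. (\<Sum>k. indicator V x * (avoid ^^ k) u x) \<partial>\<pi>)"
  proof (rule nn_integral_suminf[symmetric])
    show "(\<lambda>x. indicator V x * (avoid ^^ k) u x) \<in> borel_measurable \<pi>" for k
      unfolding mc using V m[OF u, of k] by measurable
  qed
  finally show ?thesis by (simp add: excursion_def)
qed

text \<open>On \<open>V\<close> the law \<open>\<pi>\<close> is invariant for the embedded chain:
  Kac's formula applied to \<open>hit u\<close> leaves one step of the full chain, which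
  stationarity absorbs.\<close>

lemma nn_integral_ret:
  assumes st: "stationary_distribution M K \<pi>"
    and rec: "\<And>x. x \<in> space M \<Longrightarrow> (INF n. (avoid ^^ n) (\<lambda>_. 1) x) = 0"
    and u: "u \<in> borel_measurable M" and bound: "\<And>x. x \<in> V \<Longrightarrow> u x \<le> ennreal c"
  shows "(\<integral>\<^sup>+x. indicator V x * ret u x \<partial>\<pi>) = (\<integral>\<^sup>+x. indicator V x * u x \<partial>\<pi>)"
proof -
  have s: "sets \<pi> = sets M" and b: "\<pi> \<bind> K = \<pi>"
    using st by (auto simp: stationary_distribution_def space_prob_algebra)
  have i: "(\<lambda>x. indicator V x * u x) \<in> borel_measurable M" using V u by measurable
  have le: "hit u x \<le> ennreal c" if x: "x \<in> space M" for x
  proof -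
    have "hit u x \<le> hit (\<lambda>_. ennreal c) x" by (rule hit.mono[OF bound x])
    also have "\<dots> \<le> ennreal c * 1"
      by (subst hit.const[OF x]) (intro mult_left_mono step_in_le_1[OF x], auto)
    finally show ?thesis by simp
  qed
  have "(\<integral>\<^sup>+x. indicator V x * ret u x \<partial>\<pi>) = (\<integral>\<^sup>+x. hit u x \<partial>\<pi>)"
    unfolding return_op_def by (rule kac_formula[OF st rec hit.measurable_op[OF u] le])
  also have "\<dots> = (\<integral>\<^sup>+x. indicator V x * u x \<partial>(\<pi> \<bind> K))"
    unfolding step_in_def
  proof (rule nn_integral_bind[OF i, symmetric])
    show "K \<in> \<pi> \<rightarrow>\<^sub>M subprob_algebra M"
      unfolding measurable_cong_sets[OF s refl] by (rule measurable_prob_algebraD[OF kernel])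
  qed
  finally show ?thesis unfolding b .
qed

end

text \<open>\<open>W\<close> bounds the mean return time to \<open>D\<close> but may be infinite off
  \<open>V\<close>, so it settles almost sure return only for starts in \<open>V\<close>; from
  elsewhere the chain reaches \<open>V\<close> first. In the proof, \<open>?u\<close> is the
  probability of never entering \<open>D\<close> after time 0.\<close>

lemma (in markov_set) positive_recurrent_subset:
  assumes D: "D \<in> sets M" "D \<subseteq> V"
    and rec: "\<And>x. x \<in> space M \<Longrightarrow> (INF n. (avoid ^^ n) (\<lambda>_. 1) x) = 0"
    and W: "W \<in> borel_measurable M" "\<And>x. x \<in> space M \<Longrightarrow> 1 + step_in K (space M - D) W x \<le> W x"
      "\<And>x. x \<in> V \<Longrightarrow> W x < \<infinity>" "(SUP x\<in>D. W x) < \<infinity>"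
  shows "positive_recurrent M K D"
proof -
  interpret D: markov_set M K D by standard (rule D)
  let ?u = "\<lambda>x. INF n. (D.avoid ^^ n) (\<lambda>_. 1) x"
  have le: "D.exc (\<lambda>_. 1) x \<le> W x" if x: "x \<in> space M" for x
    using D.exc_add_le[of "\<lambda>_. 1" "\<lambda>_. 0" W x] D.exc.const[OF x, of 0] W x by simp
  have zero: "?u x = 0" if x: "x \<in> V" for x
  proof (rule ccontr)
    assume nz: "?u x \<noteq> 0"
    have xs: "x \<in> space M" using x V_subset by auto
    \<comment> \<open>A positive probability of never returning would make the mean return time
      infinite.\<close>
    have "of_nat n * ?u x \<le> W x" for n
    proof -
      have "of_nat n * ?u x = (\<Sum>k<n. ?u x)" by simp
      also have "\<dots> \<le> (\<Sum>k<n. (D.avoid ^^ k) (\<lambda>_. 1) x)" by (intro sum_mono INF_lower) auto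
      also have "\<dots> \<le> D.exc (\<lambda>_. 1) x" unfolding excursion_def by (rule sum_le_suminf) auto
      also have "\<dots> \<le> W x" by (rule le[OF xs])
      finally show ?thesis .
    qed
    then have "(SUP n. of_nat n * ?u x) \<le> W x" by (intro SUP_least)
    then have "top * ?u x \<le> W x"
      by (simp add: SUP_mult_right_ennreal[symmetric] ennreal_SUP_of_nat_eq_top)
    with nz W(3)[OF x] show False by (simp add: ennreal_top_mult top_unique)
  qed
  have mD: "(D.avoid ^^ n) (\<lambda>_. 1) \<in> borel_measurable M" for n
    using positive_operator.measurable_op[OF D.positive_operator_avoid_pow] by simp
  have le1: "(D.avoid ^^ n) (\<lambda>_. 1) x \<le> 1" if x: "x \<in> space M" for n x
    using decseqD[OF D.avoid_pow_decseq[OF x], of 0 n] by simp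
  have u_step: "?u x \<le> D.avoid ?u x" if x: "x \<in> space M" for x
  proof -
    let ?f = "\<lambda>n y. indicator (space M - D) y * (D.avoid ^^ n) (\<lambda>_. 1) y"
    have "D.avoid ?u x = (\<integral>\<^sup>+y. (INF n. ?f n y) \<partial>K x)"
      unfolding step_in_def by (intro nn_integral_cong) (auto split: split_indicator)
    also have "\<dots> = (INF n. \<integral>\<^sup>+y. ?f n y \<partial>K x)"
    proof (rule nn_integral_monotone_convergence_INF_AE)
      show "AE y in K x. ?f (Suc n) y \<le> ?f n y" for n
        using D.avoid_pow_decseq unfolding decseq_Suc_iff
        by (intro AE_I2 mult_left_mono) (auto simp: space_kernel x)
      show "?f n \<in> borel_measurable (K x)" for n
        unfolding measurable_kernel_iff[OF x] using D(1) mD[of n] by measurable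
      have "(\<integral>\<^sup>+y. ?f 0 y \<partial>K x) \<le> 1" using step_in_le_1[OF x] by (simp add: step_in_def)
      then show "(\<integral>\<^sup>+y. ?f 0 y \<partial>K x) < \<infinity>" by (rule le_less_trans) simp
    qed
    also have "\<dots> = (INF n. (D.avoid ^^ Suc n) (\<lambda>_. 1) x)" by (simp add: step_in_def[of K "space M - D"])
    finally have eq: "D.avoid ?u x = (INF n. (D.avoid ^^ Suc n) (\<lambda>_. 1) x)" .
    show ?thesis unfolding eq by (rule INF_greatest) (rule INF_lower, simp)
  qed
  have "?u x \<le> (avoid ^^ n) (\<lambda>_. 1) x" if x: "x \<in> space M" for n x
    using x
  proof (induction n arbitrary: x)
    case 0
    show ?case using INF_lower[of 0 UNIV "\<lambda>n. (D.avoid ^^ n) (\<lambda>_. 1) x"] by simp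
  next
    case (Suc n)
    have "?u x \<le> D.avoid ?u x" by (rule u_step[OF Suc.prems])
    \<comment> \<open>The two operators differ by landings in \<open>V - D\<close>, where
      \<open>?u\<close> vanishes.\<close>
    also have "D.avoid ?u x = avoid ?u x"
      by (rule step_in_cong[OF Suc.prems]) (use D zero in \<open>auto split: split_indicator\<close>)
    also have "\<dots> \<le> avoid ((avoid ^^ n) (\<lambda>_. 1)) x"
      by (rule avoid.mono) (use Suc in auto)
    finally show ?case by simp
  qed
  then have "?u x \<le> (INF n. (avoid ^^ n) (\<lambda>_. 1) x)" if "x \<in> space M" for x
    using that by (intro INF_greatest)
  then have "?u x = 0" if "x \<in> space M" for x
    using rec[OF that] that by (metis le_zero_eq)
  moreover have "(SUP z\<in>D. D.exc (\<lambda>_. 1) z) \<le> (SUP x\<in>D. W x)"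
    using D V_subset by (intro SUP_subset_mono le) auto
  ultimately show ?thesis
    unfolding positive_recurrent_iff using D(1) le_less_trans[OF _ W(4)] by blast
qed

section \<open>An approximate Poisson equation\<close>

text \<open>The instances are the chain watched on \<open>V\<close>, its powers and Cesaro means
  and, as an operator with constant output, the functional in Doeblin's condition.\<close>

locale averaging_operator = positive_operator +
  assumes subset: "V \<subseteq> space M" and one: "x \<in> V \<Longrightarrow> S (\<lambda>_. 1) x = 1"
begin

lemma le_const:
  assumes "\<And>x. x \<in> V \<Longrightarrow> u x \<le> c" and x: "x \<in> V"
  shows "S u x \<le> c"
proof -
  have "S u x \<le> S (\<lambda>_. c) x" using assms subset by (intro mono) auto
  then show ?thesis using const[of x c] one[OF x] x subset by auto
qed

lemma measurable_pow: "u \<in> borel_measurable M \<Longrightarrow> (S ^^ n) u \<in> borel_measurable M"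
  by (induction n) (auto intro: measurable_op)

lemma pow_le_const:
  assumes "\<And>x. x \<in> V \<Longrightarrow> u x \<le> c" and "x \<in> V"
  shows "(S ^^ n) u x \<le> c"
  using assms(2) by (induction n arbitrary: x) (use assms(1) in \<open>auto intro: le_const\<close>)

text \<open>All points of \<open>V\<close> share the portion \<open>q * \<nu>\<close> of their
  averages, so only the remaining \<open>1 - q\<close> can spread the values. The upper bound on
  \<open>S v\<close> comes from applying the minorization to the complement
  \<open>w = s - v\<close>, since inequalities cannot be subtracted in
  \<open>ennreal\<close>.\<close>

lemma doeblin_step:
  assumes \<nu>: "averaging_operator M V (\<lambda>u _. \<nu> u)" and q: "0 \<le> q" "q \<le> 1"
    and minor: "\<And>u x. u \<in> borel_measurable M \<Longrightarrow> x \<in> V \<Longrightarrow> ennreal q * \<nu> u \<le> S u x"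
    and g: "g \<in> borel_measurable M" and s: "0 \<le> s" and a: "a < top"
    and bounds: "\<And>x. x \<in> V \<Longrightarrow> a \<le> g x \<and> g x \<le> a + ennreal s"
  shows "\<exists>a'<top. \<forall>x\<in>V. a' \<le> S g x \<and> S g x \<le> a' + ennreal ((1 - q) * s)"
proof (cases "V = {}")
  case True
  then show ?thesis by (intro exI[of _ 0]) auto
next
  case False
  interpret \<nu>: averaging_operator M V "\<lambda>u _. \<nu> u" by fact
  \<comment> \<open>Off \<open>V\<close> nothing is known about \<open>g\<close>. The truncation,
    inactive on \<open>V\<close>, makes \<open>v + w\<close> equal to \<open>s\<close>
    everywhere.\<close>
  define v where "v x = min (g x - a) (ennreal s)" for x
  define w where "w x = ennreal s - v x" for x
  have v: "v \<in> borel_measurable M" and w: "w \<in> borel_measurable M"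
    unfolding w_def v_def using g by measurable
  have vw: "(\<lambda>x. v x + w x) = (\<lambda>_. ennreal s)"
    by (simp add: v_def w_def add_diff_eq_ennreal ennreal_add_diff_cancel_right add.commute[of _ "_ - _"] diff_add_cancel_ennreal)
  have g_eq: "g x = a + v x" if "x \<in> V" for x
  proof -
    have "g x - a \<le> ennreal s" using bounds[OF that] a by (auto simp: ennreal_minus_le_iff add.commute)
    then show ?thesis using bounds[OF that] by (simp add: v_def min_absorb1 add_diff_inverse_ennreal)
  qed
  have vs: "v x \<le> ennreal s" for x by (simp add: v_def)
  have Sg: "S g x = a + S v x" if x: "x \<in> V" for x
  proof -
    have xs: "x \<in> space M" using x subset by auto
    have "S g x = S (\<lambda>x. a + v x) x" by (rule cong[OF g_eq xs])
    also have "\<dots> = S (\<lambda>_. a) x + S v x" by (rule add) (use v xs in auto)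
    also have "S (\<lambda>_. a) x = a" using const[OF xs, of a] one[OF x] by simp
    finally show ?thesis .
  qed
  have sum_S: "S v x + S w x = ennreal s" if x: "x \<in> V" for x
  proof -
    have xs: "x \<in> space M" using x subset by auto
    show ?thesis using add[OF v w xs] const[OF xs, of "ennreal s"] one[OF x] by (simp add: vw)
  qed
  have sum_\<nu>: "\<nu> v + \<nu> w = ennreal s"
  proof -
    obtain x where x: "x \<in> V" "x \<in> space M" using False subset by auto
    show ?thesis using \<nu>.add[OF v w x(2)] \<nu>.const[OF x(2), of "ennreal s"] \<nu>.one[OF x(1)] by (simp add: vw)
  qed
  \<comment> \<open>The new lower end. The new upper end is \<open>a + s - q * \<nu> w\<close>,
    which equals \<open>?a + (1 - q) * s\<close> because
    \<open>\<nu> v + \<nu> w = s\<close>.\<close>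
  let ?a = "a + ennreal q * \<nu> v"
  have "\<nu> v \<le> ennreal s" unfolding sum_\<nu>[symmetric] by simp
  then have "\<nu> v < top" by (rule le_less_trans) simp
  then have fin: "?a < top" using a by (simp add: ennreal_mult_less_top)
  have "S g x \<le> ?a + ennreal ((1 - q) * s)" if x: "x \<in> V" for x
  proof -
    have "S v x + ennreal q * \<nu> w \<le> S v x + S w x" by (intro add_left_mono minor w x)
    then have le: "S v x + ennreal q * \<nu> w \<le> ennreal s" by (simp add: sum_S[OF x])
    have qs: "ennreal (q * s) = ennreal q * \<nu> v + ennreal q * \<nu> w"
      using q s by (simp add: ennreal_mult sum_\<nu>[symmetric] distrib_left)
    have ss: "ennreal s = ennreal (q * s) + ennreal ((1 - q) * s)"
      using q s by (subst ennreal_plus[symmetric]) (auto simp: algebra_simps mult_left_le_one_le)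
    have "ennreal (q * s) + S v x = (S v x + ennreal q * \<nu> w) + ennreal q * \<nu> v"
      unfolding qs by (simp add: ac_simps)
    also have "\<dots> \<le> ennreal s + ennreal q * \<nu> v" by (intro add_right_mono le)
    also have "\<dots> = ennreal (q * s) + (ennreal ((1 - q) * s) + ennreal q * \<nu> v)"
      unfolding ss by (simp add: ac_simps)
    finally have "S v x \<le> ennreal ((1 - q) * s) + ennreal q * \<nu> v"
      by (simp add: ennreal_add_left_cancel_le)
    then have "a + S v x \<le> a + (ennreal ((1 - q) * s) + ennreal q * \<nu> v)" by (rule add_left_mono)
    then show ?thesis unfolding Sg[OF x] by (simp add: ac_simps)
  qed
  moreover have "?a \<le> S g x" if x: "x \<in> V" for x
    unfolding Sg[OF x] by (intro add_left_mono minor v x)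
  ultimately show ?thesis using fin by (intro exI[of _ ?a]) auto
qed

lemma doeblin_pow:
  assumes \<nu>: "averaging_operator M V (\<lambda>u _. \<nu> u)" and q: "0 \<le> q" "q \<le> 1"
    and minor: "\<And>u x. u \<in> borel_measurable M \<Longrightarrow> x \<in> V \<Longrightarrow> ennreal q * \<nu> u \<le> S u x"
    and g: "g \<in> borel_measurable M" and C: "0 \<le> C" "\<And>x. x \<in> V \<Longrightarrow> g x \<le> ennreal C"
  shows "\<exists>a<top. \<forall>x\<in>V. a \<le> (S ^^ n) g x \<and> (S ^^ n) g x \<le> a + ennreal ((1 - q) ^ n * C)"
proof (induction n)
  case 0
  show ?case using C by (intro exI[of _ 0]) auto
next
  case (Suc n)
  then obtain a where a: "a < top"
    and le: "\<And>x. x \<in> V \<Longrightarrow> a \<le> (S ^^ n) g x \<and> (S ^^ n) g x \<le> a + ennreal ((1 - q) ^ n * C)"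
    by blast
  have "0 \<le> (1 - q) ^ n * C" using q C by simp
  from doeblin_step[OF \<nu> q minor measurable_pow[OF g] this a le]
  show ?case by (simp add: mult.assoc)
qed

text \<open>High powers of \<open>S\<close> are almost constant on \<open>V\<close>, and invariance
  keeps their mean over \<open>V\<close> fixed. So the lower end of their range is at most
  \<open>b\<close>, and the upper end exceeds it by less than \<open>\<eta>\<close>.\<close>

lemma pow_le_mean:
  assumes \<nu>: "averaging_operator M V (\<lambda>u _. \<nu> u)" and q: "0 < q" "q \<le> 1"
    and minor: "\<And>u x. u \<in> borel_measurable M \<Longrightarrow> x \<in> V \<Longrightarrow> ennreal q * \<nu> u \<le> S u x"
    and g: "g \<in> borel_measurable M" and C: "0 \<le> C" "\<And>x. x \<in> V \<Longrightarrow> g x \<le> ennreal C"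
    and \<pi>: "sets \<pi> = sets M" "V \<in> sets M" "0 < emeasure \<pi> V" "emeasure \<pi> V < top"
    and inv: "\<And>u c. u \<in> borel_measurable M \<Longrightarrow> (\<And>x. x \<in> V \<Longrightarrow> u x \<le> ennreal c) \<Longrightarrow>
      (\<integral>\<^sup>+x. indicator V x * S u x \<partial>\<pi>) = (\<integral>\<^sup>+x. indicator V x * u x \<partial>\<pi>)"
    and mean: "(\<integral>\<^sup>+x. indicator V x * g x \<partial>\<pi>) \<le> b * emeasure \<pi> V" and \<eta>: "0 < \<eta>"
  shows "\<exists>n. \<forall>x\<in>V. (S ^^ n) g x \<le> b + ennreal \<eta>"
proof -
  have "(\<lambda>n. (1 - q) ^ n * C) \<longlonglongrightarrow> 0 * C"
    using q by (intro tendsto_mult LIMSEQ_power_zero tendsto_const) auto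
  then have "\<forall>\<^sub>F n in sequentially. (1 - q) ^ n * C < \<eta>"
    using \<eta> by (intro order_tendstoD(2)) auto
  then obtain n where n: "(1 - q) ^ n * C < \<eta>" by (auto simp: eventually_sequentially)
  obtain a where a: "\<And>x. x \<in> V \<Longrightarrow> a \<le> (S ^^ n) g x" "\<And>x. x \<in> V \<Longrightarrow> (S ^^ n) g x \<le> a + ennreal ((1 - q) ^ n * C)"
    using doeblin_pow[OF \<nu> _ q(2) minor g C, of n] q(1) by auto
  have "(\<integral>\<^sup>+x. indicator V x * (S ^^ n) g x \<partial>\<pi>) = (\<integral>\<^sup>+x. indicator V x * g x \<partial>\<pi>)" for n
  proof (induction n)
    case (Suc n)
    show ?case using inv[OF measurable_pow[OF g] pow_le_const[OF C(2)], of n] Suc by simp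
  qed simp
  moreover have "a * emeasure \<pi> V = (\<integral>\<^sup>+x. a * indicator V x \<partial>\<pi>)"
    using \<pi> by (subst nn_integral_cmult_indicator) auto
  moreover have "\<dots> \<le> (\<integral>\<^sup>+x. indicator V x * (S ^^ n) g x \<partial>\<pi>)"
    by (rule nn_integral_mono) (use a(1) in \<open>auto split: split_indicator\<close>)
  ultimately have "emeasure \<pi> V * a \<le> emeasure \<pi> V * b"
    using mean by (simp add: mult.commute)
  then have "a \<le> b" using \<pi>(3,4) by (simp add: ennreal_mult_le_mult_iff)
  then have "(S ^^ n) g x \<le> b + ennreal \<eta>" if "x \<in> V" for x
    using n by (intro order_trans[OF a(2)[OF that]] add_mono ennreal_leI) auto
  then show ?thesis by blast
qed

lemma averaging_operator_pow:
  "averaging_operator M V (S ^^ Suc n)"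
proof -
  interpret P: positive_operator M V "S ^^ Suc n"
    by (rule positive_operator_funpow_Suc[OF positive_operator_axioms subset])
  have pow1: "(S ^^ n) (\<lambda>_. 1) x = 1" if "x \<in> V" for x n
    using that
  proof (induction n arbitrary: x)
    case (Suc n)
    have "S ((S ^^ n) (\<lambda>_. 1)) x = S (\<lambda>_. 1) x"
      by (rule cong) (use Suc subset in auto)
    then show ?case using Suc.prems by (simp add: one)
  qed simp
  show ?thesis by unfold_locales (use subset pow1[of _ "Suc n"] in auto)
qed

text \<open>Exponents run from 1 to \<open>k\<close>: exponent 0, the identity, would see points
  outside \<open>V\<close>.\<close>

definition cesaro :: "nat \<Rightarrow> ('a \<Rightarrow> ennreal) \<Rightarrow> 'a \<Rightarrow> ennreal" where
  "cesaro k u x = ennreal (1 / k) * (\<Sum>j<k. (S ^^ Suc j) u x)"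

lemma ennreal_inverse_mult_of_nat: "0 < k \<Longrightarrow> ennreal (1 / real k) * of_nat k = 1"
  by (simp add: ennreal_of_nat_eq_real_of_nat ennreal_mult[symmetric])

lemma averaging_operator_cesaro:
  assumes k: "0 < k"
  shows "averaging_operator M V (cesaro k)"
proof -
  interpret P: averaging_operator M V "S ^^ Suc j" for j by (rule averaging_operator_pow)
  interpret C: positive_operator M V "cesaro k"
    unfolding cesaro_def[abs_def]
    by (intro positive_operator_scale positive_operator_sum P.positive_operator_axioms)
  show ?thesis
    by unfold_locales (use subset in \<open>simp_all add: cesaro_def P.one ennreal_inverse_mult_of_nat[OF k] del: funpow.simps\<close>)
qed

text \<open>\<open>H\<close> is the average over \<open>j < k\<close> of the sums of
  \<open>(S ^^ i) v\<close> with \<open>i \<le> j\<close>. Under \<open>S\<close> each sum loses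
  \<open>v\<close> and gains \<open>(S ^^ Suc j) v\<close>, so \<open>v\<close> is traded exactly
  for its Cesaro mean.\<close>

lemma poisson_step:
  assumes k: "0 < k" and v: "v \<in> borel_measurable M" and C: "\<And>x. x \<in> V \<Longrightarrow> v x \<le> ennreal C"
  shows "\<exists>H\<in>borel_measurable M. (\<forall>x\<in>V. H x \<le> of_nat k * ennreal C) \<and>
    (\<forall>x\<in>V. S H x + v x = H x + cesaro k v x)"
proof -
  let ?c = "ennreal (1 / k)"
  define H where "H x = ?c * (\<Sum>j<k. \<Sum>i<Suc j. (S ^^ i) v x)" for x
  note m = measurable_pow[OF v]
  have H: "H \<in> borel_measurable M"
    unfolding H_def[abs_def] by (intro borel_measurable_times_ennreal borel_measurable_sum m) simp
  have "H x \<le> of_nat k * ennreal C" if x: "x \<in> V" for x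
  proof -
    have "H x \<le> ?c * (\<Sum>j<k. \<Sum>i<k. ennreal C)"
      unfolding H_def
    proof (intro mult_left_mono sum_mono)
      fix j assume "j \<in> {..<k}"
      then have "(\<Sum>i<Suc j. (S ^^ i) v x) \<le> (\<Sum>i<k. (S ^^ i) v x)" by (intro sum_mono2) auto
      also have "\<dots> \<le> (\<Sum>i<k. ennreal C)" by (intro sum_mono pow_le_const[OF C x])
      finally show "(\<Sum>i<Suc j. (S ^^ i) v x) \<le> (\<Sum>i<k. ennreal C)" .
    qed auto
    also have "\<dots> = (?c * of_nat k) * (of_nat k * ennreal C)" by (simp add: mult.assoc)
    finally show ?thesis by (simp add: ennreal_inverse_mult_of_nat[OF k])
  qed
  moreover have "S H x + v x = H x + cesaro k v x" if x: "x \<in> V" for x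
  proof -
    have xs: "x \<in> space M" using x subset by auto
    have "S H x = ?c * S (\<lambda>x. \<Sum>j<k. \<Sum>i<Suc j. (S ^^ i) v x) x"
      unfolding H_def[abs_def] by (intro cmult borel_measurable_sum m xs)
    also have "S (\<lambda>x. \<Sum>j<k. \<Sum>i<Suc j. (S ^^ i) v x) x = (\<Sum>j<k. S (\<lambda>x. \<Sum>i<Suc j. (S ^^ i) v x) x)"
      by (intro sum borel_measurable_sum m xs)
    also have "\<dots> = (\<Sum>j<k. \<Sum>i<Suc j. S ((S ^^ i) v) x)"
      by (intro sum.cong refl sum m xs)
    finally have SH: "S H x = ?c * (\<Sum>j<k. \<Sum>i<Suc j. (S ^^ Suc i) v x)" by simp
    have vx: "v x = ?c * (\<Sum>j<k. v x)"
      using ennreal_inverse_mult_of_nat[OF k] by (simp add: mult.assoc[symmetric])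
    have tele: "(\<Sum>i<Suc j. (S ^^ Suc i) v x) + v x = (\<Sum>i<Suc j. (S ^^ i) v x) + (S ^^ Suc j) v x" for j
      using sum.lessThan_Suc_shift[of "\<lambda>i. (S ^^ i) v x" "Suc j"]
      by (simp only: sum.lessThan_Suc[of _ "Suc j"] funpow_0 id_apply) (simp add: ac_simps)
    have "S H x + v x = ?c * (\<Sum>j<k. (\<Sum>i<Suc j. (S ^^ Suc i) v x) + v x)"
      by (subst vx) (simp only: SH sum.distrib distrib_left)
    also have "\<dots> = ?c * (\<Sum>j<k. (\<Sum>i<Suc j. (S ^^ i) v x) + (S ^^ Suc j) v x)"
      by (simp only: tele)
    also have "\<dots> = H x + cesaro k v x"
      by (simp only: H_def cesaro_def sum.distrib distrib_left)
    finally show ?thesis .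
  qed
  ultimately show ?thesis using H by blast
qed

text \<open>Correctors add up: the Cesaro mean left over by one of them is the function to be
  corrected by the next.\<close>

lemma poisson_pow:
  assumes k: "0 < k" and g: "g \<in> borel_measurable M" and C: "\<And>x. x \<in> V \<Longrightarrow> g x \<le> ennreal C"
  shows "\<exists>G\<in>borel_measurable M. (\<forall>x\<in>V. G x \<le> of_nat (n * k) * ennreal C) \<and>
    (\<forall>x\<in>V. S G x + g x = G x + (cesaro k ^^ n) g x)"
proof (induction n)
  case 0
  have "S (\<lambda>_. 0) x = 0" if "x \<in> V" for x
    using const[of x 0] that subset by auto
  then show ?case by (intro bexI[of _ "\<lambda>_. 0"]) auto
next
  case (Suc n)
  then obtain G where G: "G \<in> borel_measurable M" "\<And>x. x \<in> V \<Longrightarrow> G x \<le> of_nat (n * k) * ennreal C"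
    "\<And>x. x \<in> V \<Longrightarrow> S G x + g x = G x + (cesaro k ^^ n) g x" by blast
  interpret C: averaging_operator M V "cesaro k" by (rule averaging_operator_cesaro[OF k])
  obtain H where H: "H \<in> borel_measurable M" "\<And>x. x \<in> V \<Longrightarrow> H x \<le> of_nat k * ennreal C"
    "\<And>x. x \<in> V \<Longrightarrow> S H x + (cesaro k ^^ n) g x = H x + cesaro k ((cesaro k ^^ n) g) x"
    using poisson_step[OF k C.measurable_pow[OF g] C.pow_le_const[OF C]] by blast
  show ?case
  proof (intro bexI[of _ "\<lambda>x. G x + H x"] conjI ballI)
    fix x assume x: "x \<in> V"
    then have xs: "x \<in> space M" using subset by auto
    show "G x + H x \<le> of_nat (Suc n * k) * ennreal C"
      using add_mono[OF G(2)[OF x] H(2)[OF x]] by (simp add: distrib_right add.commute)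
    have "S (\<lambda>x. G x + H x) x + g x = (S G x + g x) + S H x"
      by (simp add: add[OF G(1) H(1) xs] ac_simps)
    also have "\<dots> = G x + (S H x + (cesaro k ^^ n) g x)"
      unfolding G(3)[OF x] by (simp add: ac_simps)
    also have "\<dots> = G x + H x + (cesaro k ^^ Suc n) g x"
      unfolding H(3)[OF x] by (simp add: ac_simps)
    finally show "S (\<lambda>x. G x + H x) x + g x = G x + H x + (cesaro k ^^ Suc n) g x" .
  qed (use G H in simp)
qed

text \<open>Trading \<open>g\<close> for a power of the Cesaro operator is exact; only the
  flattening of that power to its mean costs \<open>\<eta>\<close>.\<close>

lemma poisson_inequality:
  assumes k: "0 < k" and \<nu>: "averaging_operator M V (\<lambda>u _. \<nu> u)" and q: "0 < q" "q \<le> 1"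
    and minor: "\<And>u x. u \<in> borel_measurable M \<Longrightarrow> x \<in> V \<Longrightarrow> ennreal q * \<nu> u \<le> (\<Sum>j<k. (S ^^ Suc j) u x)"
    and g: "g \<in> borel_measurable M" and C: "0 \<le> C" "\<And>x. x \<in> V \<Longrightarrow> g x \<le> ennreal C"
    and \<pi>: "sets \<pi> = sets M" "V \<in> sets M" "0 < emeasure \<pi> V" "emeasure \<pi> V < top"
    and inv: "\<And>u c. u \<in> borel_measurable M \<Longrightarrow> (\<And>x. x \<in> V \<Longrightarrow> u x \<le> ennreal c) \<Longrightarrow>
      (\<integral>\<^sup>+x. indicator V x * S u x \<partial>\<pi>) = (\<integral>\<^sup>+x. indicator V x * u x \<partial>\<pi>)"
    and mean: "(\<integral>\<^sup>+x. indicator V x * g x \<partial>\<pi>) \<le> b * emeasure \<pi> V" and \<eta>: "0 < \<eta>"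
  shows "\<exists>G\<in>borel_measurable M. (\<exists>B<top. \<forall>x\<in>V. G x \<le> B) \<and> (\<forall>x\<in>V. S G x + g x \<le> G x + (b + ennreal \<eta>))"
proof -
  interpret C: averaging_operator M V "cesaro k" by (rule averaging_operator_cesaro[OF k])
  have "\<exists>n. \<forall>x\<in>V. (cesaro k ^^ n) g x \<le> b + ennreal \<eta>"
  \<comment> \<open>The hypothesis minorizes a sum of \<open>k\<close> powers, so their mean is
    minorized with constant \<open>q / k\<close>.\<close>
  proof (rule C.pow_le_mean[OF \<nu> _ _ _ g C \<pi> _ mean \<eta>, where q="q / k"])
    show "0 < q / k" "q / k \<le> 1" using q k by (auto simp: field_simps)
    fix u :: "'a \<Rightarrow> ennreal" assume u: "u \<in> borel_measurable M"
    show "ennreal (q / k) * \<nu> u \<le> cesaro k u x" if "x \<in> V" for x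
    proof -
      have "ennreal (q / k) * \<nu> u = ennreal (1 / k) * (ennreal q * \<nu> u)"
        using q by (simp add: ennreal_mult[symmetric] mult.assoc[symmetric])
      also have "\<dots> \<le> cesaro k u x"
        unfolding cesaro_def by (intro mult_left_mono minor u that) simp
      finally show ?thesis .
    qed
    fix c assume c: "\<And>x. x \<in> V \<Longrightarrow> u x \<le> ennreal c"
    note m = measurable_cong_sets[OF \<pi>(1) refl]
    have mi: "(\<lambda>x. indicator V x * (S ^^ j) u x) \<in> borel_measurable \<pi>" for j
      unfolding m using measurable_pow[OF u, of j] \<pi>(2) by measurable
    have pow: "(\<integral>\<^sup>+x. indicator V x * (S ^^ j) u x \<partial>\<pi>) = (\<integral>\<^sup>+x. indicator V x * u x \<partial>\<pi>)" for j
    proof (induction j)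
      case (Suc j)
      show ?case using inv[OF measurable_pow[OF u] pow_le_const[OF c], of j] Suc by simp
    qed simp
    have "(\<integral>\<^sup>+x. indicator V x * cesaro k u x \<partial>\<pi>) = (\<integral>\<^sup>+x. ennreal (1 / k) * (\<Sum>j<k. indicator V x * (S ^^ Suc j) u x) \<partial>\<pi>)"
      unfolding cesaro_def by (intro nn_integral_cong) (simp only: sum_distrib_left mult.left_commute)
    also have "\<dots> = ennreal (1 / k) * (\<integral>\<^sup>+x. (\<Sum>j<k. indicator V x * (S ^^ Suc j) u x) \<partial>\<pi>)"
      by (intro nn_integral_cmult borel_measurable_sum mi)
    also have "\<dots> = ennreal (1 / k) * (\<Sum>j<k. \<integral>\<^sup>+x. indicator V x * (S ^^ Suc j) u x \<partial>\<pi>)"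
      by (subst nn_integral_sum) (intro mi refl)+
    also have "\<dots> = ennreal (1 / k) * of_nat k * (\<integral>\<^sup>+x. indicator V x * u x \<partial>\<pi>)"
      unfolding pow by (simp add: mult.assoc)
    finally show "(\<integral>\<^sup>+x. indicator V x * cesaro k u x \<partial>\<pi>) = (\<integral>\<^sup>+x. indicator V x * u x \<partial>\<pi>)"
      by (simp add: ennreal_inverse_mult_of_nat[OF k])
  qed
  then obtain n where n: "\<And>x. x \<in> V \<Longrightarrow> (cesaro k ^^ n) g x \<le> b + ennreal \<eta>" by blast
  obtain G where G: "G \<in> borel_measurable M" "\<And>x. x \<in> V \<Longrightarrow> G x \<le> of_nat (n * k) * ennreal C"
    "\<And>x. x \<in> V \<Longrightarrow> S G x + g x = G x + (cesaro k ^^ n) g x"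
    using poisson_pow[OF k g C(2), of n] by blast
  have "of_nat (n * k) * ennreal C < top" by (simp add: ennreal_mult_less_top ennreal_of_nat_eq_real_of_nat del: of_nat_mult)
  moreover have "S G x + g x \<le> G x + (b + ennreal \<eta>)" if "x \<in> V" for x
    unfolding G(3)[OF that] by (intro add_left_mono n that)
  ultimately show ?thesis using G(1,2) by blast
qed

end

section \<open>Drift at return times\<close>

text \<open>Off \<open>V\<close> no drift of \<open>W\<close> is known, so the test function
  \<open>H\<close> adds the mean time to the next visit and a multiple of the mean of
  \<open>W\<close> there. With the factor \<open>t / d\<close> the drift at a visit outside
  \<open>D\<close> is worth \<open>t\<close>, which pays for the following excursion.\<close>

lemma (in markov_set) positive_recurrent_of_return_drift:
  assumes D: "D \<in> sets M" "D \<subseteq> V"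
    and rec: "\<And>x. x \<in> space M \<Longrightarrow> (INF n. (avoid ^^ n) (\<lambda>_. 1) x) = 0"
    and t: "\<And>x. x \<in> V \<Longrightarrow> exc (\<lambda>_. 1) x \<le> ennreal t" "0 \<le> t"
    and W: "W \<in> borel_measurable M" and d: "0 < d"
    and drift: "\<And>x. x \<in> V - D \<Longrightarrow> ret W x + ennreal d \<le> W x"
    and fin: "\<And>x. x \<in> V \<Longrightarrow> ret W x < top" and B: "B < top" "\<And>x. x \<in> D \<Longrightarrow> ret W x \<le> B"
  shows "positive_recurrent M K D"
proof -
  let ?k = "ennreal (t / d)"
  define H where "H x = exc (\<lambda>_. 1) x + ?k * ret W x" for x
  have T: "exc (\<lambda>_. 1) \<in> borel_measurable M" by (rule exc.measurable_op) simp
  have rW: "ret W \<in> borel_measurable M" by (rule ret.measurable_op[OF W])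
  have H: "H \<in> borel_measurable M" unfolding H_def[abs_def] using T rW by measurable
  have H_le: "H x \<le> ?k * W x" if x: "x \<in> V - D" for x
  proof -
    have "H x \<le> ennreal t + ?k * ret W x" unfolding H_def using x by (intro add_right_mono t) auto
    also have "ennreal t = ?k * ennreal d" using d t(2) by (simp add: ennreal_mult[symmetric])
    also have "?k * ennreal d + ?k * ret W x = ?k * (ret W x + ennreal d)"
      by (simp add: distrib_left add.commute)
    also have "\<dots> \<le> ?k * W x" by (intro mult_left_mono drift x) simp
    finally show ?thesis .
  qed
  have step: "1 + step_in K (space M - D) H x \<le> H x" if x: "x \<in> space M" for x
  proof -
    have m: "(\<lambda>y. indicator (space M - V) y * H y) \<in> borel_measurable (K x)"
      "(\<lambda>y. indicator V y * (?k * W y)) \<in> borel_measurable (K x)"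
      unfolding measurable_kernel_iff[OF x] using V H W by measurable
    \<comment> \<open>Landings in \<open>D\<close> contribute nothing on the left, those in
      \<open>V - D\<close> are covered by \<open>H_le\<close>, and the rest is
      \<open>avoid H\<close>.\<close>
    have "step_in K (space M - D) H x \<le>
        (\<integral>\<^sup>+y. indicator (space M - V) y * H y + indicator V y * (?k * W y) \<partial>K x)"
      unfolding step_in_def
      by (rule nn_integral_mono) (use H_le in \<open>auto split: split_indicator simp: space_kernel[OF x]\<close>)
    also have "\<dots> = avoid H x + hit (\<lambda>y. ?k * W y) x"
      unfolding step_in_def by (rule nn_integral_add[OF m])
    also have "avoid H x = avoid (exc (\<lambda>_. 1)) x + ?k * avoid (ret W) x"
      unfolding H_def[abs_def] using T rW x by (simp add: avoid.add avoid.cmult)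
    also have "hit (\<lambda>y. ?k * W y) x = ?k * hit W x" by (rule hit.cmult[OF W x])
    finally have "step_in K (space M - D) H x \<le> avoid (exc (\<lambda>_. 1)) x + ?k * (hit W x + avoid (ret W) x)"
      by (simp add: distrib_left ac_simps)
    then have "1 + step_in K (space M - D) H x \<le> 1 + (avoid (exc (\<lambda>_. 1)) x + ?k * ret W x)"
      unfolding ret_eq[OF W x] by (rule add_left_mono)
    also have "\<dots> = H x"
      unfolding H_def using exc_eq[of "\<lambda>_. 1" x] x by (simp add: add.assoc)
    finally show ?thesis .
  qed
  show ?thesis
  proof (rule positive_recurrent_subset[OF D rec H step])
    fix x assume x: "x \<in> V"
    then show "H x < \<infinity>"
      unfolding H_def using le_less_trans[OF t(1)[OF x] ennreal_less_top] fin[OF x] by (simp add: ennreal_mult_less_top)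
  next
    have "(SUP x\<in>D. H x) \<le> ennreal t + ?k * B"
      unfolding H_def using D(2) by (intro SUP_least add_mono mult_left_mono t B) auto
    also have "\<dots> < \<infinity>" using B(1) by (simp add: ennreal_mult_less_top)
    finally show "(SUP x\<in>D. H x) < \<infinity>" .
  qed
qed

section \<open>A chain modulated by an autonomous component\<close>

text \<open>Excursions of the joint chain are cut at visits of the first component to
  \<open>V\<close>, whatever the second component is. Thus their lengths are governed by the first
  chain alone; \<open>projection\<close> is (A0) in integrated form.\<close>

locale modulated_chain =
  X: markov_set MX KX V + J: markov_set "MX \<Otimes>\<^sub>M MY" K "V \<times> space MY"
  for MX :: "'a measure" and KX V and MY :: "'b measure" and K +
  assumes projection: "x \<in> space MX \<Longrightarrow> y \<in> space MY \<Longrightarrow> u \<in> borel_measurable MX \<Longrightarrow>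
    (\<integral>\<^sup>+z. u (fst z) \<partial>K (x, y)) = (\<integral>\<^sup>+x'. u x' \<partial>KX x)"
begin

abbreviation "Z \<equiv> MX \<Otimes>\<^sub>M MY"

lemma fst_in_space: "z \<in> space Z \<Longrightarrow> fst z \<in> space MX"
  by (auto simp: space_pair_measure)

lemma measurable_fst_comp: "u \<in> borel_measurable MX \<Longrightarrow> (\<lambda>z. u (fst z)) \<in> borel_measurable Z"
  by (rule measurable_compose[OF measurable_fst])

lemma step_in_fst:
  assumes C: "C \<in> sets MX" and u: "u \<in> borel_measurable MX" and z: "z \<in> space Z"
  shows "step_in K (C \<times> space MY) (\<lambda>z. u (fst z)) z = step_in KX C u (fst z)"
proof -
  have m: "(\<lambda>x. indicator C x * u x) \<in> borel_measurable MX" using C u by measurable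
  obtain x y where xy: "z = (x, y)" "x \<in> space MX" "y \<in> space MY"
    using z by (auto simp: space_pair_measure)
  have "step_in K (C \<times> space MY) (\<lambda>z. u (fst z)) z = (\<integral>\<^sup>+z. indicator C (fst z) * u (fst z) \<partial>K z)"
    unfolding step_in_def
    by (rule nn_integral_cong) (auto simp: J.space_kernel[OF z] space_pair_measure split: split_indicator)
  then show ?thesis
    unfolding xy(1) using projection[OF xy(2,3) m] by (simp add: step_in_def)
qed

lemma space_diff: "space Z - V \<times> space MY = (space MX - V) \<times> space MY"
  by (auto simp: space_pair_measure)

lemma avoid_fst:
  "u \<in> borel_measurable MX \<Longrightarrow> z \<in> space Z \<Longrightarrow> J.avoid (\<lambda>z. u (fst z)) z = X.avoid u (fst z)"
  unfolding space_diff by (rule step_in_fst) (use X.V in auto)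

lemma avoid_pow_fst:
  assumes u: "u \<in> borel_measurable MX" and z: "z \<in> space Z"
  shows "(J.avoid ^^ n) (\<lambda>z. u (fst z)) z = (X.avoid ^^ n) u (fst z)"
  using z
proof (induction n arbitrary: z)
  case (Suc n)
  have "(J.avoid ^^ Suc n) (\<lambda>z. u (fst z)) z = J.avoid (\<lambda>z. (X.avoid ^^ n) u (fst z)) z"
    unfolding funpow.simps comp_def by (rule J.avoid.cong) (use Suc in auto)
  also have "\<dots> = (X.avoid ^^ Suc n) u (fst z)"
    using avoid_fst[OF positive_operator.measurable_op[OF X.positive_operator_avoid_pow u] Suc.prems] by simp
  finally show ?case .
qed simp

lemma exc_fst:
  "u \<in> borel_measurable MX \<Longrightarrow> z \<in> space Z \<Longrightarrow> J.exc (\<lambda>z. u (fst z)) z = X.exc u (fst z)"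
  unfolding excursion_def[of _ KX] by (subst excursion_def) (simp only: avoid_pow_fst)

lemma ret_fst:
  assumes u: "u \<in> borel_measurable MX" and z: "z \<in> space Z"
  shows "J.ret (\<lambda>z. u (fst z)) z = X.ret u (fst z)"
proof -
  have "J.ret (\<lambda>z. u (fst z)) z = J.exc (\<lambda>z. X.hit u (fst z)) z"
    unfolding return_op_def by (rule J.exc.cong[OF _ z]) (rule step_in_fst[OF X.V u])
  also have "\<dots> = X.ret u (fst z)"
    unfolding return_op_def by (rule exc_fst[OF X.hit.measurable_op[OF u] z])
  finally show ?thesis .
qed

text \<open>A level far below the initial one is reached only after a long excursion: up to time \<open>n\<close>
  use Markov's inequality for \<open>(a - L2)\<^sup>+\<close>, which grows by at most \<open>U\<close> per step in mean, and after
  time \<open>n\<close> forget the level.\<close>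

lemma exc_level_le:
  assumes L2: "L2 \<in> borel_measurable MY"
    and U: "\<And>z. z \<in> space Z \<Longrightarrow> (\<integral>\<^sup>+w. ennreal \<bar>L2 (snd w) - L2 (snd z)\<bar> \<partial>K z) \<le> ennreal U" "0 \<le> U"
    and z: "z \<in> space Z" and N: "N < L2 (snd z)"
  shows "J.exc (indicator {w. L2 (snd w) < N}) z \<le>
    ennreal (real n * (real n * U / (L2 (snd z) - N))) + X.exc ((X.avoid ^^ n) (\<lambda>_. 1)) (fst z)"
proof -
  define a where "a = L2 (snd z)"
  \<comment> \<open>\<open>ennreal\<close> sends negative numbers to 0, so this is a positive part;
    it vanishes at the starting point \<open>z\<close>.\<close>
  define \<psi> where "\<psi> w = ennreal (a - L2 (snd w))" for w :: "'a \<times> 'b"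
  let ?I = "indicator {w. L2 (snd w) < N} :: 'a \<times> 'b \<Rightarrow> ennreal"
  have Lm: "(\<lambda>w. L2 (snd w)) \<in> borel_measurable Z" by (rule measurable_compose[OF measurable_snd L2])
  have \<psi>: "\<psi> \<in> borel_measurable Z" unfolding \<psi>_def[abs_def] using Lm by measurable
  have "{w \<in> space Z. L2 (snd w) < N} \<in> sets Z" using Lm by measurable
  then have I: "?I \<in> borel_measurable Z" by (simp add: borel_measurable_indicator_iff Int_def conj_commute)
  have pow: "(J.avoid ^^ k) \<psi> w \<le> \<psi> w + ennreal (real k * U)" if w: "w \<in> space Z" for k w
    using w
  proof (induction k arbitrary: w)
    case (Suc k)
    have "(J.avoid ^^ Suc k) \<psi> w \<le> J.avoid (\<lambda>w. \<psi> w + ennreal (real k * U)) w"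
      unfolding funpow.simps comp_def by (rule J.avoid.mono) (use Suc in auto)
    also have "\<dots> = J.avoid \<psi> w + J.avoid (\<lambda>_. ennreal (real k * U)) w"
      by (rule J.avoid.add[OF \<psi> _ Suc.prems]) simp
    also have "J.avoid (\<lambda>_. ennreal (real k * U)) w \<le> ennreal (real k * U) * 1"
      by (subst J.avoid.const[OF Suc.prems]) (intro mult_left_mono J.step_in_le_1 Suc.prems, simp)
    also have "J.avoid \<psi> w \<le> (\<integral>\<^sup>+v. \<psi> w + ennreal \<bar>L2 (snd v) - L2 (snd w)\<bar> \<partial>K w)"
      unfolding step_in_def
    proof (rule nn_integral_mono)
      fix v
      have "\<psi> v \<le> ennreal (max 0 (a - L2 (snd w)) + \<bar>L2 (snd v) - L2 (snd w)\<bar>)"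
        unfolding \<psi>_def by (rule ennreal_leI) auto
      also have "\<dots> = \<psi> w + ennreal \<bar>L2 (snd v) - L2 (snd w)\<bar>"
        unfolding \<psi>_def by (subst ennreal_plus) auto
      finally show "indicator (space Z - V \<times> space MY) v * \<psi> v \<le> \<psi> w + ennreal \<bar>L2 (snd v) - L2 (snd w)\<bar>"
        by (auto split: split_indicator)
    qed
    also have "\<dots> = \<psi> w + (\<integral>\<^sup>+v. ennreal \<bar>L2 (snd v) - L2 (snd w)\<bar> \<partial>K w)"
      using prob_space.emeasure_space_1[OF J.prob_space_kernel[OF Suc.prems]] Lm
      by (subst nn_integral_add) (simp_all add: J.measurable_kernel_iff[OF Suc.prems])
    also have "\<dots> \<le> \<psi> w + ennreal U" by (intro add_left_mono U Suc.prems)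
    finally have "(J.avoid ^^ Suc k) \<psi> w \<le> \<psi> w + (ennreal U + ennreal (real k * U))"
      by (simp add: add_right_mono add.assoc)
    then show ?case using U(2) by (simp add: distrib_right ennreal_plus)
  qed simp
  have aN: "0 < a - N" using N by (simp add: a_def)
  have Ipow: "(J.avoid ^^ k) ?I z \<le> ennreal (real k * U / (a - N))" for k
  proof -
    interpret P: positive_operator Z "space Z" "J.avoid ^^ k" by (rule J.positive_operator_avoid_pow)
    \<comment> \<open>Below \<open>N\<close> the drop from \<open>a\<close> exceeds
      \<open>a - N\<close>, so the scaled \<open>\<psi>\<close> is at least 1 there.\<close>
    have "?I w \<le> ennreal (1 / (a - N)) * \<psi> w" for w
    proof (cases "L2 (snd w) < N")
      case True
      then have "1 \<le> 1 / (a - N) * (a - L2 (snd w))" using aN by (simp add: field_simps)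
      then have "ennreal 1 \<le> ennreal (1 / (a - N) * (a - L2 (snd w)))" by (rule ennreal_leI)
      also have "\<dots> = ennreal (1 / (a - N)) * \<psi> w"
        unfolding \<psi>_def using aN True by (subst ennreal_mult) auto
      finally show ?thesis using True by simp
    qed simp
    then have "(J.avoid ^^ k) ?I z \<le> (J.avoid ^^ k) (\<lambda>w. ennreal (1 / (a - N)) * \<psi> w) z"
      by (intro P.mono z)
    also have "\<dots> = ennreal (1 / (a - N)) * (J.avoid ^^ k) \<psi> z" by (rule P.cmult[OF \<psi> z])
    also have "\<dots> \<le> ennreal (1 / (a - N)) * (\<psi> z + ennreal (real k * U))" by (intro mult_left_mono pow z) simp
    also have "\<psi> z = 0" by (simp add: \<psi>_def a_def)
    finally show ?thesis using aN U(2) by (simp add: ennreal_mult[symmetric])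
  qed
  \<comment> \<open>The first \<open>n\<close> terms cost at most \<open>n * U / (a - N)\<close>
    each, because \<open>k < n\<close>; the others form an excursion sum started from the
    \<open>n\<close>-th power.\<close>
  have "J.exc ?I z = (\<Sum>k. (J.avoid ^^ (k + n)) ?I z) + (\<Sum>k<n. (J.avoid ^^ k) ?I z)"
    unfolding excursion_def by (rule suminf_offset) simp
  also have "(\<Sum>k<n. (J.avoid ^^ k) ?I z) \<le> (\<Sum>k<n. ennreal (real n * U / (a - N)))"
    using aN U(2) by (intro sum_mono order_trans[OF Ipow] ennreal_leI divide_right_mono mult_right_mono) auto
  also have "\<dots> = ennreal (real n * (real n * U / (a - N)))"
    using aN U(2) by (simp add: ennreal_of_nat_eq_real_of_nat ennreal_mult[symmetric])
  also have "(\<Sum>k. (J.avoid ^^ (k + n)) ?I z) = J.exc ((J.avoid ^^ n) ?I) z"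
    unfolding excursion_def by (simp add: funpow_add)
  also have "\<dots> \<le> J.exc (\<lambda>z. (X.avoid ^^ n) (\<lambda>_. 1) (fst z)) z"
  proof (rule J.exc.mono[OF _ z])
    fix w assume w: "w \<in> space Z"
    interpret P: positive_operator Z "space Z" "J.avoid ^^ n" by (rule J.positive_operator_avoid_pow)
    have "(J.avoid ^^ n) ?I w \<le> (J.avoid ^^ n) (\<lambda>_. 1) w" by (rule P.mono[OF _ w]) (simp add: indicator_def)
    then show "(J.avoid ^^ n) ?I w \<le> (X.avoid ^^ n) (\<lambda>_. 1) (fst w)"
      using avoid_pow_fst[of "\<lambda>_. 1" w n] w by simp
  qed
  also have "\<dots> = X.exc ((X.avoid ^^ n) (\<lambda>_. 1)) (fst z)"
    by (rule exc_fst[OF _ z]) (rule positive_operator.measurable_op[OF X.positive_operator_avoid_pow], simp)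
  finally show ?thesis by (simp add: a_def add.commute add_left_mono add_right_mono)
qed

end

section \<open>The corrector on \<open>V\<close> and the choice of the level\<close>

lemma (in markov_set) exists_potential:
  assumes st: "stationary_distribution M K \<pi>"
    and rec: "\<And>x. x \<in> space M \<Longrightarrow> (INF n. (avoid ^^ n) (\<lambda>_. 1) x) = 0"
    and t: "\<And>x. x \<in> V \<Longrightarrow> exc (\<lambda>_. 1) x \<le> ennreal t" "0 \<le> t"
    and k: "0 < k" and \<nu>: "averaging_operator M V (\<lambda>u _. \<nu> u)" and q: "0 < q" "q \<le> 1"
    and minor: "\<And>u x. u \<in> borel_measurable M \<Longrightarrow> x \<in> V \<Longrightarrow> ennreal q * \<nu> u \<le> (\<Sum>j<k. (ret ^^ Suc j) u x)"
    and F: "F \<in> borel_measurable M" "\<And>x. x \<in> space M \<Longrightarrow> F x \<le> ennreal Fm" "0 \<le> Fm"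
    and mean: "(\<integral>\<^sup>+x. F x \<partial>\<pi>) + ennreal \<epsilon> \<le> ennreal c" "0 < \<epsilon>" "0 \<le> c"
    and h0: "0 \<le> h0"
  shows "\<exists>n. \<exists>\<delta>>0. \<exists>G\<in>borel_measurable M. (\<exists>B<top. \<forall>x\<in>V. G x \<le> B) \<and>
    (\<forall>x\<in>V. ret G x + (exc F x + ennreal h0 * exc ((avoid ^^ n) (\<lambda>_. 1)) x) + ennreal \<delta> \<le> G x + ennreal c * exc (\<lambda>_. 1) x)"
proof -
  have s: "sets \<pi> = sets M" and "prob_space \<pi>"
    using st by (auto simp: stationary_distribution_def space_prob_algebra)
  interpret \<pi>: prob_space \<pi> by fact
  note mc = measurable_cong_sets[OF s refl]
  interpret Q: averaging_operator M V ret
  proof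
    show "ret (\<lambda>_. 1) x = 1" if "x \<in> V" for x using ret_1 rec that V_subset by auto
  qed (rule V_subset)
  define T where "T = exc (\<lambda>_. 1)"
  have T: "T \<in> borel_measurable M" unfolding T_def by (rule exc.measurable_op) simp
  have Tt: "T x \<le> ennreal t" if "x \<in> V" for x using t(1)[OF that] by (simp add: T_def)
  have i: "(\<lambda>x. indicator V x * u x) \<in> borel_measurable \<pi>" if "u \<in> borel_measurable M" for u :: "'a \<Rightarrow> ennreal"
    unfolding mc using that V by measurable
  have kac: "(\<integral>\<^sup>+x. indicator V x * exc u x \<partial>\<pi>) = (\<integral>\<^sup>+x. u x \<partial>\<pi>)"
    if "u \<in> borel_measurable M" "\<And>x. x \<in> space M \<Longrightarrow> u x \<le> ennreal C" for u C
    by (rule kac_formula[OF st rec that])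
  \<comment> \<open>Kac's formula for \<open>u = 1\<close>. Together with \<open>T \<le> t\<close>
    on \<open>V\<close> it forces \<open>\<pi>\<close> to charge \<open>V\<close>.\<close>
  have intT: "(\<integral>\<^sup>+x. indicator V x * T x \<partial>\<pi>) = 1"
    unfolding T_def using kac[of "\<lambda>_. 1" 1] \<pi>.emeasure_space_1 by simp
  define v where "v = measure \<pi> V"
  have v: "emeasure \<pi> V = ennreal v" by (simp add: v_def \<pi>.emeasure_eq_measure)
  have "1 \<le> (\<integral>\<^sup>+x. ennreal t * indicator V x \<partial>\<pi>)"
    unfolding intT[symmetric] by (rule nn_integral_mono) (use Tt in \<open>auto split: split_indicator\<close>)
  also have "\<dots> = ennreal (t * v)"
    using V t(2) by (simp add: nn_integral_cmult_indicator s v ennreal_mult v_def)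
  finally have tv: "1 \<le> t * v" by simp
  then have v0: "0 < v"
    using measure_nonneg[of \<pi> V] by (auto simp: v_def less_le)
  let ?r = "\<lambda>n. exc ((avoid ^^ n) (\<lambda>_. 1))"
  have mp: "(avoid ^^ n) (\<lambda>_. 1) \<in> borel_measurable M" for n
    by (rule positive_operator.measurable_op[OF positive_operator_avoid_pow]) simp
  have le1: "(avoid ^^ n) (\<lambda>_. 1) x \<le> 1" if x: "x \<in> space M" for n x
    using decseqD[OF avoid_pow_decseq[OF x], of 0 n] by simp
  have "(\<lambda>n. ennreal h0 * (\<integral>\<^sup>+x. (avoid ^^ n) (\<lambda>_. 1) x \<partial>\<pi>)) \<longlonglongrightarrow> ennreal h0 * 0"
    by (intro ennreal_tendsto_cmult tendsto_nn_integral_avoid_pow[OF \<pi>.prob_space_axioms s rec, where c=1]) auto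
  then have "\<forall>\<^sub>F n in sequentially. ennreal h0 * (\<integral>\<^sup>+x. (avoid ^^ n) (\<lambda>_. 1) x \<partial>\<pi>) < ennreal (\<epsilon> / 2)"
    using mean(2) by (intro order_tendstoD(2)) auto
  \<comment> \<open>Half of \<open>\<epsilon>\<close> pays for the time after \<open>n\<close>; the
    other half survives as drift.\<close>
  then obtain n where n: "ennreal h0 * (\<integral>\<^sup>+x. (avoid ^^ n) (\<lambda>_. 1) x \<partial>\<pi>) \<le> ennreal (\<epsilon> / 2)"
    unfolding eventually_sequentially by (meson less_imp_le order_refl)
  have rm: "?r n \<in> borel_measurable M" by (rule exc.measurable_op[OF mp])
  have eF: "exc F \<in> borel_measurable M" by (rule exc.measurable_op[OF F(1)])
  have r_le: "?r n x \<le> ennreal t" if x: "x \<in> V" for x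
  proof -
    have "?r n x \<le> T x" unfolding T_def by (rule exc.mono[OF le1]) (use x V_subset in auto)
    then show ?thesis using Tt[OF x] by (rule order_trans)
  qed
  have exc_F: "exc F x \<le> ennreal (Fm * t)" if x: "x \<in> V" for x
  proof -
    have xs: "x \<in> space M" using x V_subset by auto
    have "exc F x \<le> ennreal Fm * T x"
      using exc.mono[OF F(2) xs] exc.const[OF xs, of "ennreal Fm"] by (simp add: T_def)
    also have "\<dots> \<le> ennreal Fm * ennreal t" by (intro mult_left_mono Tt x) simp
    finally show ?thesis using F(3) t(2) by (simp add: ennreal_mult)
  qed
  \<comment> \<open>The last term stands for \<open>- c * T\<close>, shifted by \<open>c * t\<close>
    to be non-negative; the subtraction is genuine on \<open>V\<close>, where
    \<open>T \<le> t\<close>.\<close>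
  define g where "g x = exc F x + ennreal h0 * ?r n x + ennreal c * (ennreal t - T x)" for x
  have g: "g \<in> borel_measurable M" unfolding g_def[abs_def] using eF rm T by measurable
  have g_le: "g x \<le> ennreal (Fm * t + h0 * t + c * t)" if x: "x \<in> V" for x
  proof -
    have "ennreal h0 * ?r n x \<le> ennreal (h0 * t)"
      using mult_left_mono[OF r_le[OF x], of "ennreal h0"] h0 t(2) by (simp add: ennreal_mult)
    moreover have "ennreal c * (ennreal t - T x) \<le> ennreal (c * t)"
      using mult_left_mono[of "ennreal t - T x" "ennreal t" "ennreal c"] mean(3) t(2)
      by (simp add: ennreal_mult diff_le_self_ennreal)
    ultimately have "g x \<le> ennreal (Fm * t) + ennreal (h0 * t) + ennreal (c * t)"
      unfolding g_def by (intro add_mono exc_F x)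
    then show ?thesis using F(3) h0 mean(3) t(2) by (simp add: ennreal_plus)
  qed
  have C: "0 \<le> Fm * t + h0 * t + c * t" using F(3) h0 mean(3) t(2) by simp
  have cT: "ennreal c * (ennreal t - T x) + ennreal c * T x = ennreal (c * t)" if "x \<in> V" for x
    using Tt[OF that] mean(3) t(2) by (simp add: distrib_left[symmetric] diff_add_cancel_ennreal ennreal_mult)
  define I where "I = (\<integral>\<^sup>+x. indicator V x * g x \<partial>\<pi>)"
  \<comment> \<open>Adding \<open>c\<close>, which is \<open>c\<close> times the integral of
    \<open>T\<close> over \<open>V\<close>, undoes the subtraction inside \<open>g\<close>.\<close>
  have "I + ennreal c = I + (\<integral>\<^sup>+x. ennreal c * (indicator V x * T x) \<partial>\<pi>)"
    by (subst nn_integral_cmult) (simp_all add: i T intT)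
  also have "\<dots> = (\<integral>\<^sup>+x. indicator V x * g x + ennreal c * (indicator V x * T x) \<partial>\<pi>)"
    unfolding I_def by (rule nn_integral_add[symmetric]) (use i[OF g] i[OF T] in auto)
  also have "\<dots> = (\<integral>\<^sup>+x. indicator V x * exc F x + ennreal h0 * (indicator V x * ?r n x) + ennreal (c * t) * indicator V x \<partial>\<pi>)"
  proof (rule nn_integral_cong)
    fix x
    show "indicator V x * g x + ennreal c * (indicator V x * T x) =
      indicator V x * exc F x + ennreal h0 * (indicator V x * ?r n x) + ennreal (c * t) * indicator V x"
      using cT[of x] by (cases "x \<in> V") (simp_all add: g_def add.assoc)
  qed
  also have "\<dots> = (\<integral>\<^sup>+x. indicator V x * exc F x \<partial>\<pi>) + ennreal h0 * (\<integral>\<^sup>+x. indicator V x * ?r n x \<partial>\<pi>) + ennreal (c * t) * emeasure \<pi> V"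
    using i[OF eF] i[OF rm] V by (simp add: nn_integral_add nn_integral_cmult nn_integral_cmult_indicator s mc)
  also have "\<dots> = (\<integral>\<^sup>+x. F x \<partial>\<pi>) + ennreal h0 * (\<integral>\<^sup>+x. (avoid ^^ n) (\<lambda>_. 1) x \<partial>\<pi>) + ennreal (c * t * v)"
  proof -
    have "(\<integral>\<^sup>+x. indicator V x * ?r n x \<partial>\<pi>) = (\<integral>\<^sup>+x. (avoid ^^ n) (\<lambda>_. 1) x \<partial>\<pi>)"
      by (rule kac_formula[OF st rec mp, where c=1]) (auto simp: le1)
    moreover have "ennreal (c * t) * emeasure \<pi> V = ennreal (c * t * v)"
      using mean(3) t(2) v0 by (simp add: v ennreal_mult)
    ultimately show ?thesis by (simp only: kac[OF F(1,2)])
  qed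
  finally have I_eq: "I + ennreal c = \<dots>" .
  have "ennreal (c + \<epsilon> / 2) + (I + ennreal (\<epsilon> / 2)) = (I + ennreal c) + ennreal \<epsilon>"
    using mean(2,3) by (simp add: ennreal_plus[symmetric] add.assoc add.left_commute[of _ I] del: ennreal_plus)
  also have "\<dots> = ((\<integral>\<^sup>+x. F x \<partial>\<pi>) + ennreal \<epsilon>) + ennreal h0 * (\<integral>\<^sup>+x. (avoid ^^ n) (\<lambda>_. 1) x \<partial>\<pi>) + ennreal (c * t * v)"
    unfolding I_eq by (simp add: ac_simps)
  also have "\<dots> \<le> ennreal c + ennreal (\<epsilon> / 2) + ennreal (c * t * v)"
    by (intro add_mono mean n order_refl)
  also have "\<dots> = ennreal (c + \<epsilon> / 2) + ennreal (c * t * v)" using mean(2,3) by (simp add: ennreal_plus)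
  finally have I_le: "I + ennreal (\<epsilon> / 2) \<le> ennreal (c * t * v)"
    by (simp add: ennreal_add_left_cancel_le)
  \<comment> \<open>Ensures that \<open>b\<close> below is non-negative, so that
    \<open>ennreal b\<close> truncates nothing.\<close>
  then have "ennreal (\<epsilon> / 2) \<le> ennreal (c * t * v)" by (rule order_trans[rotated]) simp
  then have ev: "\<epsilon> / 2 \<le> c * t * v" using mean(3) t(2) v0 by (simp add: ennreal_le_iff)
  \<comment> \<open>\<open>b\<close> bounds the mean of \<open>g\<close> per unit of
    \<open>\<pi>\<close>-mass of \<open>V\<close>. Its distance \<open>\<epsilon> / (2 * v)\<close>
    from \<open>c * t\<close> is cut into two halves \<open>\<delta>\<close>: one for the error in
    the Poisson equation, one for the drift.\<close>
  define b where "b = c * t - \<epsilon> / (2 * v)"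
  define \<delta> where "\<delta> = \<epsilon> / (4 * v)"
  have b: "0 \<le> b" "b * v = c * t * v - \<epsilon> / 2" using ev v0 by (auto simp: b_def field_simps)
  have \<delta>: "0 < \<delta>" "b + \<delta> + \<delta> = c * t" using mean(2) v0 by (auto simp: b_def \<delta>_def field_simps)
  have "I + ennreal (\<epsilon> / 2) \<le> ennreal (b * v) + ennreal (\<epsilon> / 2)"
    using I_le ev mean(2) unfolding b(2) by (subst ennreal_plus[symmetric]) auto
  then have I_b: "I \<le> ennreal b * emeasure \<pi> V"
    using b(1) v0 by (simp add: v ennreal_mult)
  have pi: "0 < emeasure \<pi> V" "emeasure \<pi> V < top" using v0 by (auto simp: v)
  have "\<exists>G\<in>borel_measurable M. (\<exists>B<top. \<forall>x\<in>V. G x \<le> B) \<and>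
      (\<forall>x\<in>V. ret G x + g x \<le> G x + (ennreal b + ennreal \<delta>))"
  proof (rule Q.poisson_inequality[OF k \<nu> q minor g C _ s V pi _ _ \<delta>(1)])
    fix u :: "'a \<Rightarrow> ennreal" and c
    assume u: "u \<in> borel_measurable M" and c: "\<And>x. x \<in> V \<Longrightarrow> u x \<le> ennreal c"
    show "(\<integral>\<^sup>+x. indicator V x * ret u x \<partial>\<pi>) = (\<integral>\<^sup>+x. indicator V x * u x \<partial>\<pi>)"
      by (rule nn_integral_ret[OF st rec u c])
  qed (use g_le I_b in \<open>simp_all add: I_def\<close>)
  then obtain G where G: "G \<in> borel_measurable M" "\<exists>B<top. \<forall>x\<in>V. G x \<le> B"
    "\<And>x. x \<in> V \<Longrightarrow> ret G x + g x \<le> G x + (ennreal b + ennreal \<delta>)"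
    by (elim bexE conjE) simp
  have "ret G x + (exc F x + ennreal h0 * ?r n x) + ennreal \<delta> \<le> G x + ennreal c * exc (\<lambda>_. 1) x" if x: "x \<in> V" for x
  proof -
    \<comment> \<open>Added to both sides to restore the subtracted \<open>c * T\<close>, then
      cancelled since it is finite.\<close>
    let ?d = "ennreal c * (ennreal t - T x)"
    have "?d + (ret G x + (exc F x + ennreal h0 * ?r n x) + ennreal \<delta>) = (ret G x + g x) + ennreal \<delta>"
      by (simp add: g_def ac_simps)
    also have "\<dots> \<le> G x + (ennreal b + ennreal \<delta>) + ennreal \<delta>" by (intro add_right_mono G x)
    also have "\<dots> = G x + ennreal (c * t)"
      using b(1) \<delta>(1) unfolding \<delta>(2)[symmetric] by (simp add: add.assoc del: mult_2 flip: ennreal_plus)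
    also have "\<dots> = ?d + (G x + ennreal c * T x)" unfolding cT[OF x, symmetric] by (simp add: ac_simps)
    finally have "?d + (ret G x + (exc F x + ennreal h0 * ?r n x) + ennreal \<delta>) \<le> ?d + (G x + ennreal c * T x)" .
    moreover have "?d < top" using cT[OF x] by (metis ennreal_add_eq_top ennreal_neq_top top.not_eq_extremum)
    ultimately show ?thesis unfolding T_def[symmetric] by (auto simp: ennreal_add_left_cancel_le)
  qed
  with G(1,2) \<delta>(1) show ?thesis by blast
qed

text \<open>Order of the choices: \<open>n\<close>, \<open>\<delta>\<close> and \<open>G\<close> are
  given; \<open>N\<close> makes \<open>h N\<close> small against \<open>\<delta>\<close>;
  \<open>N0\<close> is so far above \<open>N\<close> that the time spent below \<open>N\<close>
  during the first \<open>n\<close> steps is small in mean. One quarter of \<open>\<delta>\<close>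
  is spent on \<open>h N\<close>, one quarter on \<open>N0\<close>, and half remains as
  drift.\<close>

lemma (in modulated_chain) positive_recurrent_level_set:
  assumes rec: "\<And>x. x \<in> space MX \<Longrightarrow> (INF n. (X.avoid ^^ n) (\<lambda>_. 1) x) = 0"
    and t: "\<And>x. x \<in> V \<Longrightarrow> X.exc (\<lambda>_. 1) x \<le> ennreal t" "0 \<le> t"
    and L2: "L2 \<in> borel_measurable MY"
    and U: "\<And>z. z \<in> space Z \<Longrightarrow> (\<integral>\<^sup>+w. ennreal \<bar>L2 (snd w) - L2 (snd z)\<bar> \<partial>K z) \<le> ennreal U" "0 \<le> U"
    and h: "(h \<longlongrightarrow> 0) at_top" and h0: "0 \<le> h0"
    and F: "F \<in> borel_measurable MX" "\<And>x. x \<in> space MX \<Longrightarrow> F x \<le> ennreal Fm" "0 \<le> Fm"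
    and drift: "\<And>N z. 0 \<le> N \<Longrightarrow> z \<in> space Z \<Longrightarrow>
      (\<integral>\<^sup>+w. ennreal (L2 (snd w)) \<partial>K z) + ennreal c \<le>
        ennreal (L2 (snd z)) + (F (fst z) + ennreal (h N) + ennreal h0 * indicator {w. L2 (snd w) < N} z)"
    and \<delta>: "0 < \<delta>" and G: "G \<in> borel_measurable MX" and B: "B < top" "\<And>x. x \<in> V \<Longrightarrow> G x \<le> B"
    and pot: "\<And>x. x \<in> V \<Longrightarrow> X.ret G x + (X.exc F x + ennreal h0 * X.exc ((X.avoid ^^ n) (\<lambda>_. 1)) x) + ennreal \<delta>
      \<le> G x + ennreal c * X.exc (\<lambda>_. 1) x"
  shows "\<exists>N0. positive_recurrent Z K (V \<times> {y \<in> space MY. L2 y \<le> N0})"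
proof -
  define T where "T = X.exc (\<lambda>_. 1)"
  have T: "T \<in> borel_measurable MX" unfolding T_def by (rule X.exc.measurable_op) simp
  have Tt: "T x \<le> ennreal t" if "x \<in> V" for x using t(1)[OF that] by (simp add: T_def)
  let ?L = "\<lambda>z. ennreal (L2 (snd z)) :: ennreal"
  let ?I = "\<lambda>N. indicator {w. L2 (snd w) < N} :: 'a \<times> 'b \<Rightarrow> ennreal"
  let ?r = "X.exc ((X.avoid ^^ n) (\<lambda>_. 1))"
  have Lm: "(\<lambda>w. L2 (snd w)) \<in> borel_measurable Z" by (rule measurable_compose[OF measurable_snd L2])
  then have L: "?L \<in> borel_measurable Z" by measurable
  have I: "?I N \<in> borel_measurable Z" for N
  proof -
    have "{w \<in> space Z. L2 (snd w) < N} \<in> sets Z" using Lm by measurable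
    then show ?thesis by (simp add: borel_measurable_indicator_iff Int_def conj_commute)
  qed
  have V_space: "x \<in> space MX" if "x \<in> V" for x using that X.V_subset by auto
  have mr: "?r \<in> borel_measurable MX"
    by (rule X.exc.measurable_op[OF positive_operator.measurable_op[OF X.positive_operator_avoid_pow]]) simp
  have exc_const: "J.exc (\<lambda>_. a) z = a * T (fst z)" if z: "z \<in> space Z" for a z
    using J.exc.const[OF z, of a] exc_fst[of "\<lambda>_. 1", OF _ z] by (simp add: T_def)
  have exc_F: "X.exc F x \<le> ennreal (Fm * t)" if x: "x \<in> V" for x
  proof -
    have "X.exc F x \<le> ennreal Fm * T x"
      using X.exc.mono[OF F(2) V_space[OF x]] X.exc.const[OF V_space[OF x], of "ennreal Fm"] by (simp add: T_def)
    also have "\<dots> \<le> ennreal Fm * ennreal t" by (intro mult_left_mono Tt x) simp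
    finally show ?thesis using F(3) t(2) by (simp add: ennreal_mult)
  qed
  have r_le: "?r x \<le> ennreal t" if x: "x \<in> V" for x
  proof -
    have "?r x \<le> T x" unfolding T_def
    proof (rule X.exc.mono[OF _ V_space[OF x]])
      fix y assume y: "y \<in> space MX"
      show "(X.avoid ^^ n) (\<lambda>_. 1) y \<le> 1" using decseqD[OF X.avoid_pow_decseq[OF y], of 0 n] by simp
    qed
    then show ?thesis using Tt[OF x] by (rule order_trans)
  qed
  have return_drift: "J.ret ?L z + ennreal c * T (fst z) \<le>
      ?L z + (X.exc F (fst z) + ennreal (h N) * T (fst z) + ennreal h0 * J.exc (?I N) z)"
    if N: "0 \<le> N" and z: "z \<in> space Z" for N z
  proof -
    have mF: "(\<lambda>z. F (fst z)) \<in> borel_measurable Z" by (rule measurable_fst_comp[OF F(1)])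
    have "J.ret ?L z + J.exc (\<lambda>_. ennreal c) z \<le>
        ?L z + J.exc (\<lambda>z. F (fst z) + ennreal (h N) + ennreal h0 * ?I N z) z"
      by (rule J.excursion_inequality[OF _ _ L _ z]) (use drift[OF N] mF I[of N] in auto)
    also have "J.exc (\<lambda>z. F (fst z) + ennreal (h N) + ennreal h0 * ?I N z) z =
        J.exc (\<lambda>z. F (fst z) + ennreal (h N)) z + J.exc (\<lambda>z. ennreal h0 * ?I N z) z"
      by (rule J.exc.add[OF _ _ z]) (use mF I[of N] in auto)
    also have "J.exc (\<lambda>z. F (fst z) + ennreal (h N)) z = J.exc (\<lambda>z. F (fst z)) z + J.exc (\<lambda>_. ennreal (h N)) z"
      by (rule J.exc.add[OF mF _ z]) simp
    also have "J.exc (\<lambda>z. ennreal h0 * ?I N z) z = ennreal h0 * J.exc (?I N) z"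
      by (rule J.exc.cmult[OF I z])
    finally show ?thesis by (simp only: exc_const[OF z] exc_fst[OF F(1) z])
  qed
  obtain N where N: "0 \<le> N" "h N * t \<le> \<delta> / 4"
  proof -
    have "((\<lambda>N. h N * t) \<longlongrightarrow> 0 * t) at_top" by (intro tendsto_mult h tendsto_const)
    then have "\<forall>\<^sub>F N in at_top. h N * t < \<delta> / 4" using \<delta> by (intro order_tendstoD(2)) auto
    then have "\<forall>\<^sub>F N in at_top. h N * t < \<delta> / 4 \<and> 0 \<le> N"
      using eventually_ge_at_top by (rule eventually_conj)
    then obtain N where "h N * t < \<delta> / 4 \<and> 0 \<le> N" unfolding eventually_at_top_linorder by blast
    then show thesis by (intro that[of N]) auto
  qed
  \<comment> \<open>The numerator in \<open>exc_level_le\<close> times \<open>h0\<close>. At levels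
    above \<open>N0\<close> its quotient by \<open>L2 - N\<close> is at most
    \<open>\<delta> / 4\<close>.\<close>
  define M where "M = h0 * (real n * (real n * U))"
  have M: "0 \<le> M" using h0 U(2) by (simp add: M_def)
  define N0 where "N0 = N + 1 + 4 * M / \<delta>"
  let ?D = "V \<times> {y \<in> space MY. L2 y \<le> N0}"
  define W where "W z = ?L z + G (fst z)" for z
  have mG: "(\<lambda>z. G (fst z)) \<in> borel_measurable Z" by (rule measurable_fst_comp[OF G])
  have W: "W \<in> borel_measurable Z" unfolding W_def[abs_def] using L mG by measurable
  have in_space: "z \<in> space Z" "fst z \<in> V" if "z \<in> V \<times> space MY" for z
    using that V_space by (auto simp: space_pair_measure)
  have ret_W: "J.ret W z = J.ret ?L z + X.ret G (fst z)" if z: "z \<in> space Z" for z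
    unfolding W_def[abs_def] using J.ret.add[OF L mG z] ret_fst[OF G z] by simp
  have ret_G: "X.ret G x \<le> B" if x: "x \<in> V" for x
    using X.ret.mono[OF B(2) V_space[OF x]] X.ret.const[OF V_space[OF x], of B]
      X.ret_1[OF V_space[OF x] rec[OF V_space[OF x]]] by simp
  \<comment> \<open>Apart from the level itself this bound is constant, hence uniform on
    \<open>D\<close>: the time below \<open>N\<close> is simply estimated by the whole
    excursion.\<close>
  have ret_W_le: "J.ret W z \<le> ?L z + (ennreal (Fm * t) + ennreal (h N) * ennreal t + ennreal h0 * ennreal t) + B"
    if zV: "z \<in> V \<times> space MY" for z
  proof -
    note z = in_space(1)[OF zV] and x = in_space(2)[OF zV]
    have "J.exc (?I N) z \<le> J.exc (\<lambda>_. 1) z" by (rule J.exc.mono[OF _ z]) (simp add: indicator_def)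
    also have "\<dots> \<le> ennreal t" using exc_const[OF z, of 1] Tt[OF x] by simp
    finally have e: "J.exc (?I N) z \<le> ennreal t" .
    have "J.ret ?L z \<le> J.ret ?L z + ennreal c * T (fst z)" by simp
    also note return_drift[OF N(1) z]
    also have "?L z + (X.exc F (fst z) + ennreal (h N) * T (fst z) + ennreal h0 * J.exc (?I N) z) \<le>
        ?L z + (ennreal (Fm * t) + ennreal (h N) * ennreal t + ennreal h0 * ennreal t)"
      by (intro add_mono mult_left_mono exc_F x Tt e order_refl) auto
    finally show ?thesis unfolding ret_W[OF z] by (intro add_mono ret_G x)
  qed
  have fin: "ennreal (Fm * t) + ennreal (h N) * ennreal t + ennreal h0 * ennreal t < top"
    by (simp add: ennreal_mult_less_top)
  have sets_level: "{y \<in> space MY. L2 y \<le> N0} \<in> sets MY" using L2 by measurable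
  have "positive_recurrent Z K ?D"
  proof (rule J.positive_recurrent_of_return_drift[where t=t and W=W and d="\<delta> / 2"
        and B="ennreal N0 + (ennreal (Fm * t) + ennreal (h N) * ennreal t + ennreal h0 * ennreal t) + B"])
    show "?D \<in> sets Z" using X.V sets_level by (rule pair_measureI)
    show "?D \<subseteq> V \<times> space MY" by auto
    show "(INF k. (J.avoid ^^ k) (\<lambda>_. 1) z) = 0" if "z \<in> space Z" for z
      using avoid_pow_fst[of "\<lambda>_. 1", OF _ that] rec[OF fst_in_space[OF that]] by simp
    show "J.exc (\<lambda>_. 1) z \<le> ennreal t" if "z \<in> V \<times> space MY" for z
      using exc_const[OF in_space(1)[OF that], of 1] Tt[OF in_space(2)[OF that]] by simp
    show "0 \<le> t" "0 < \<delta> / 2" by (use t \<delta> in auto)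
    show "W \<in> borel_measurable Z" by (rule W)
    show "J.ret W z < top" if "z \<in> V \<times> space MY" for z
      by (rule le_less_trans[OF ret_W_le[OF that]]) (use fin B(1) in simp)
    show "ennreal N0 + (ennreal (Fm * t) + ennreal (h N) * ennreal t + ennreal h0 * ennreal t) + B < top"
      using fin B(1) by simp
    show "J.ret W z \<le> ennreal N0 + (ennreal (Fm * t) + ennreal (h N) * ennreal t + ennreal h0 * ennreal t) + B"
      if z: "z \<in> ?D" for z
    proof -
      have "z \<in> V \<times> space MY" "?L z \<le> ennreal N0" using z by (auto intro: ennreal_leI)
      then show ?thesis by (intro order_trans[OF ret_W_le] add_right_mono)
    qed
    show "J.ret W z + ennreal (\<delta> / 2) \<le> W z" if zD: "z \<in> V \<times> space MY - ?D" for z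
    proof -
      have zV: "z \<in> V \<times> space MY" using zD by auto
      note z = in_space(1)[OF zV] and x = in_space(2)[OF zV]
      let ?a = "L2 (snd z)"
      have a: "N0 < ?a" using zD by auto
      have MN: "0 \<le> 4 * M / \<delta>" using M \<delta> by simp
      then have aN: "N < ?a" using a by (simp add: N0_def)
      have "M / (?a - N) \<le> \<delta> / 4"
      proof -
        have "4 * M / \<delta> < ?a - N" using a by (simp add: N0_def)
        then have "4 * M \<le> \<delta> * (?a - N)" using \<delta> by (simp add: field_simps)
        then show ?thesis using aN by (simp add: field_simps)
      qed
      then have M_le: "ennreal h0 * ennreal (real n * (real n * U / (?a - N))) \<le> ennreal (\<delta> / 4)"
        using h0 by (subst ennreal_mult'[symmetric]) (auto simp: M_def intro!: ennreal_leI)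
      have hN: "ennreal (h N) * T (fst z) \<le> ennreal (\<delta> / 4)"
      proof -
        have "ennreal (h N) * T (fst z) \<le> ennreal (h N) * ennreal t" by (intro mult_left_mono Tt x) simp
        also have "\<dots> = ennreal (h N * t)" using t(2) by (simp add: ennreal_mult'')
        also have "\<dots> \<le> ennreal (\<delta> / 4)" by (rule ennreal_leI[OF N(2)])
        finally show ?thesis .
      qed
      \<comment> \<open>The terms on which \<open>return_drift\<close> and \<open>pot\<close>
        balance each other. They are finite on \<open>V\<close>, so they can be cancelled after the
        two inequalities have been added.\<close>
      define S where "S = ennreal c * T (fst z) + (X.exc F (fst z) + ennreal h0 * ?r (fst z))"
      have "ennreal h0 * J.exc (?I N) z \<le> ennreal h0 * (ennreal (real n * (real n * U / (?a - N))) + ?r (fst z))"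
        by (intro mult_left_mono exc_level_le[OF L2 U z aN]) auto
      also have "\<dots> \<le> ennreal (\<delta> / 4) + ennreal h0 * ?r (fst z)"
        unfolding distrib_left by (intro add_right_mono M_le)
      finally have I_le: "ennreal h0 * J.exc (?I N) z \<le> ennreal (\<delta> / 4) + ennreal h0 * ?r (fst z)" .
      have "S + (J.ret W z + ennreal \<delta>) =
          (J.ret ?L z + ennreal c * T (fst z)) +
          (X.ret G (fst z) + (X.exc F (fst z) + ennreal h0 * ?r (fst z)) + ennreal \<delta>)"
        unfolding S_def ret_W[OF z] by (simp add: ac_simps)
      also have "\<dots> \<le> (?L z + (X.exc F (fst z) + ennreal (h N) * T (fst z) + ennreal h0 * J.exc (?I N) z)) +
          (G (fst z) + ennreal c * T (fst z))"
        unfolding T_def by (intro add_mono return_drift[unfolded T_def] pot N z x)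
      also have "\<dots> \<le> (?L z + (X.exc F (fst z) + ennreal (\<delta> / 4) + (ennreal (\<delta> / 4) + ennreal h0 * ?r (fst z)))) +
          (G (fst z) + ennreal c * T (fst z))"
        by (intro add_mono order_refl hN I_le)
      also have "\<dots> = S + (W z + (ennreal (\<delta> / 4) + ennreal (\<delta> / 4)))"
        unfolding S_def W_def by (simp add: ac_simps)
      also have "ennreal (\<delta> / 4) + ennreal (\<delta> / 4) = ennreal (\<delta> / 2)"
        using \<delta> by (subst ennreal_plus[symmetric]) auto
      finally have le: "S + (J.ret W z + ennreal \<delta>) \<le> S + (W z + ennreal (\<delta> / 2))" .
      have "S < top"
        using le_less_trans[OF Tt[OF x]] le_less_trans[OF exc_F[OF x]] le_less_trans[OF r_le[OF x]]
        by (simp add: S_def ennreal_mult_less_top)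
      with le have "J.ret W z + ennreal \<delta> \<le> W z + ennreal (\<delta> / 2)" by (auto simp: ennreal_add_left_cancel_le)
      moreover have "ennreal \<delta> = ennreal (\<delta> / 2) + ennreal (\<delta> / 2)"
        using \<delta> by (subst ennreal_plus[symmetric]) auto
      ultimately have "ennreal (\<delta> / 2) + (J.ret W z + ennreal (\<delta> / 2)) \<le> ennreal (\<delta> / 2) + W z"
        by (simp add: ac_simps)
      then show ?thesis by (simp add: ennreal_add_left_cancel_le)
    qed
  qed
  then show ?thesis by blast
qed

section \<open>From the hypotheses on paths to operators\<close>

lemma (in markov_kernel) nn_integral_path_law_1:
  assumes z: "z \<in> space M" and u: "u \<in> borel_measurable M"
  shows "(\<integral>\<^sup>+\<omega>. u (\<omega> 1) \<partial>path_law M K z) = (\<integral>\<^sup>+y. u y \<partial>K z)"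
  by (subst distr_path_law_1[OF z, symmetric], rule nn_integral_distr[OF measurable_path_coord[OF z], symmetric])
     (simp add: u)

text \<open>(A3) is tested on \<open>ret u\<close> rather than \<open>u\<close>, because
  \<open>\<mu>\<close> need not be carried by \<open>V\<close>: moving it to the next visit gives a
  functional that sees only \<open>V\<close>. Then \<open>step_pow_ret_le\<close> compares time
  \<open>m\<close> with the first \<open>Suc m\<close> returns, and its factor \<open>2 ^ m\<close>
  goes into the constant.\<close>

lemma (in markov_set) small_set_minorization:
  assumes p: "0 \<le> p" and \<mu>: "sets \<mu> = sets M" "prob_space \<mu>"
    and small: "\<And>x A. x \<in> V \<Longrightarrow> A \<in> sets M \<Longrightarrow>
      p * measure \<mu> A \<le> measure (path_law M K x) {\<omega> \<in> space (path_law M K x). \<omega> m \<in> A}"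
    and x: "x \<in> V" and u: "u \<in> borel_measurable M"
  shows "ennreal (p / 2 ^ m) * (\<integral>\<^sup>+y. ret u y \<partial>\<mu>) \<le> (\<Sum>j<Suc m. (ret ^^ Suc j) u x)"
proof -
  have xs: "x \<in> space M" using x V_subset by auto
  interpret P: prob_space "path_law M K x" by (rule prob_space_path_law[OF kernel xs])
  interpret \<mu>: prob_space \<mu> by fact
  let ?P = "path_law M K x"
  let ?N = "distr ?P M (\<lambda>\<omega>. \<omega> m)"
  note c = measurable_path_coord[OF xs, of m]
  have w: "ret u \<in> borel_measurable M" by (rule ret.measurable_op[OF u])
  have "scale_measure (ennreal p) \<mu> \<le> ?N"
  proof -
    have eq: "sets (scale_measure (ennreal p) \<mu>) = sets ?N" by (simp add: \<mu>)
    have "emeasure (scale_measure (ennreal p) \<mu>) A \<le> emeasure ?N A" if A: "A \<in> sets M" for A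
    proof -
      have "emeasure (scale_measure (ennreal p) \<mu>) A = ennreal (p * measure \<mu> A)"
        using p by (simp add: \<mu>.emeasure_eq_measure ennreal_mult)
      also have "\<dots> \<le> ennreal (measure ?P {\<omega> \<in> space ?P. \<omega> m \<in> A})"
        by (rule ennreal_leI[OF small[OF x A]])
      also have "\<dots> = emeasure ?N A"
        by (simp add: emeasure_distr[OF c A] P.emeasure_eq_measure vimage_def Int_def conj_commute)
      finally show ?thesis .
    qed
    then show ?thesis unfolding le_measure[OF eq] by (simp add: \<mu>(1))
  qed
  then have "(\<integral>\<^sup>+y. ret u y \<partial>scale_measure (ennreal p) \<mu>) \<le> (\<integral>\<^sup>+y. ret u y \<partial>?N)"
    by (intro nn_integral_mono_measure) (simp add: \<mu>)
  moreover have "(\<integral>\<^sup>+y. ret u y \<partial>scale_measure (ennreal p) \<mu>) = ennreal p * (\<integral>\<^sup>+y. ret u y \<partial>\<mu>)"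
    by (rule nn_integral_scale_measure) (use w in \<open>simp add: measurable_cong_sets[OF \<mu>(1) refl]\<close>)
  moreover have "(\<integral>\<^sup>+y. ret u y \<partial>?N) = (\<integral>\<^sup>+\<omega>. ret u (\<omega> m) \<partial>?P)"
    by (rule nn_integral_distr[OF c]) (simp add: w)
  moreover have "(\<integral>\<^sup>+\<omega>. ret u (\<omega> m) \<partial>?P) = (\<integral>\<^sup>+\<omega>. indicator {\<omega>. \<forall>i\<in>{1..m}. \<omega> i \<in> space M} \<omega> * ret u (\<omega> m) \<partial>?P)"
    using measurable_space[OF measurable_path_coord[OF xs]] by (intro nn_integral_cong) simp
  moreover have "\<dots> = (step_in K (space M) ^^ m) (ret u) x"
    by (rule nn_integral_path_taboo[OF xs _ w]) simp
  moreover note step_pow_ret_le[OF u xs, of m]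
  ultimately have "ennreal p * (\<integral>\<^sup>+y. ret u y \<partial>\<mu>) \<le> 2 ^ m * (\<Sum>j<Suc m. (ret ^^ Suc j) u x)"
    by (simp only:)
  then have "ennreal (1 / 2 ^ m) * (ennreal p * (\<integral>\<^sup>+y. ret u y \<partial>\<mu>)) \<le>
      ennreal (1 / 2 ^ m) * (2 ^ m * (\<Sum>j<Suc m. (ret ^^ Suc j) u x))"
    by (rule mult_left_mono) simp
  moreover have "ennreal (1 / 2 ^ m) * 2 ^ m = 1"
  proof -
    have "(2 :: ennreal) ^ m = ennreal (2 ^ m)" by (simp add: ennreal_power[symmetric])
    then show ?thesis by (simp add: ennreal_mult[symmetric])
  qed
  moreover have "ennreal (1 / 2 ^ m) * ennreal p = ennreal (p / 2 ^ m)"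
    using p by (simp add: ennreal_mult[symmetric])
  ultimately show ?thesis by (simp only: mult.assoc[symmetric] mult_1_left)
qed

theorem theorem1:
  fixes MX :: "'a measure" and MY :: "'b measure"
    and K :: "'a \<times> 'b \<Rightarrow> ('a \<times> 'b) measure" and KX :: "'a \<Rightarrow> 'a measure"
    and V :: "'a set" and p :: real and \<mu> :: "'a measure" and m :: nat and \<pi> :: "'a measure"
    and L2 :: "'b \<Rightarrow> real" and U :: ennreal and h :: "real \<Rightarrow> real" and f :: "'a \<Rightarrow> real" and \<epsilon> :: real
  assumes "countably_generated MX" and "countably_generated MY"
    and kernel: "K \<in> (MX \<Otimes>\<^sub>M MY) \<rightarrow>\<^sub>M prob_algebra (MX \<Otimes>\<^sub>M MY)"
    and kernel_X: "KX \<in> MX \<rightarrow>\<^sub>M prob_algebra MX"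
    and A0: "\<And>x y. x \<in> space MX \<Longrightarrow> y \<in> space MY \<Longrightarrow>
       distr (path_law (MX \<Otimes>\<^sub>M MY) K (x, y)) MX (\<lambda>\<omega>. fst (\<omega> 1)) = distr (path_law MX KX x) MX (\<lambda>\<omega>. \<omega> 1)"
    and A1: "aperiodic MX KX"
    and A2: "positive_recurrent MX KX V"
    and A3: "0 < p" "p \<le> 1" "prob_space \<mu>" "sets \<mu> = sets MX" "1 \<le> m"
      "\<And>x A. x \<in> V \<Longrightarrow> A \<in> sets MX \<Longrightarrow>
         measure (path_law MX KX x) {\<omega> \<in> space (path_law MX KX x). \<omega> m \<in> A} \<ge> p * measure \<mu> A"
    and \<pi>: "stationary_distribution MX KX \<pi>"
    and L2: "L2 \<in> borel_measurable MY" "\<And>y. y \<in> space MY \<Longrightarrow> 0 \<le> L2 y"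
    and B1: "(SUP z \<in> space (MX \<Otimes>\<^sub>M MY).
        \<integral>\<^sup>+\<omega>. ennreal \<bar>L2 (snd (\<omega> 1)) - L2 (snd (\<omega> 0))\<bar> \<partial>path_law (MX \<Otimes>\<^sub>M MY) K z) \<le> U" "U < \<infinity>"
    and h: "\<And>N. 0 \<le> N \<Longrightarrow> 0 \<le> h N" "antimono_on {0..} h" "(h \<longlongrightarrow> 0) at_top"
    and f: "f \<in> borel_measurable MX" "integrable \<pi> f" "(\<integral>x. f x \<partial>\<pi>) = - \<epsilon>" "- \<epsilon> < 0"
    and B2: "\<And>x y. x \<in> space MX \<Longrightarrow> y \<in> space MY \<Longrightarrow>
       (\<integral>\<omega>. L2 (snd (\<omega> 1)) - L2 y \<partial>path_law (MX \<Otimes>\<^sub>M MY) K (x, y)) \<le> f x + h (L2 y)"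
  shows "\<exists>N0::real. positive_recurrent (MX \<Otimes>\<^sub>M MY) K (V \<times> {y \<in> space MY. L2 y \<le> N0})"
proof (cases "space MY = {}")
  case True
  interpret J: markov_kernel "MX \<Otimes>\<^sub>M MY" K by standard (rule kernel)
  have "space (MX \<Otimes>\<^sub>M MY) = {}" using True by (simp add: space_pair_measure)
  then have "positive_recurrent (MX \<Otimes>\<^sub>M MY) K {}"
    by (simp add: J.positive_recurrent_iff bot_ennreal)
  then show ?thesis using True by simp
next
  case False
  \<comment> \<open>Some state of the second component is needed to bound \<open>f\<close> from
    below through (B2).\<close>
  then obtain y0 where y0: "y0 \<in> space MY" by auto
  let ?Z = "MX \<Otimes>\<^sub>M MY"
  interpret KX: markov_kernel MX KX by standard (rule kernel_X)
  interpret KJ: markov_kernel ?Z K by standard (rule kernel)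
  have V: "V \<in> sets MX"
    and rec: "\<And>x. x \<in> space MX \<Longrightarrow> (INF n. (step_in KX (space MX - V) ^^ n) (\<lambda>_. 1) x) = 0"
    and Sup: "(SUP x\<in>V. excursion MX KX V (\<lambda>_. 1) x) < \<infinity>"
    using A2 unfolding KX.positive_recurrent_iff by auto
  have proj: "(\<integral>\<^sup>+z. u (fst z) \<partial>K (x, y)) = (\<integral>\<^sup>+x'. u x' \<partial>KX x)"
    if x: "x \<in> space MX" and y: "y \<in> space MY" and u: "u \<in> borel_measurable MX" for x y u
  proof -
    have z: "(x, y) \<in> space ?Z" using x y by (simp add: space_pair_measure)
    have m: "(\<lambda>\<omega>. fst (\<omega> 1)) \<in> path_law ?Z K (x, y) \<rightarrow>\<^sub>M MX"
      using KJ.measurable_path_coord[OF z] measurable_fst by (rule measurable_compose)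
    have "(\<integral>\<^sup>+z. u (fst z) \<partial>K (x, y)) = (\<integral>\<^sup>+\<omega>. u (fst (\<omega> 1)) \<partial>path_law ?Z K (x, y))"
      by (rule KJ.nn_integral_path_law_1[OF z measurable_compose[OF measurable_fst u], symmetric])
    also have "\<dots> = (\<integral>\<^sup>+x'. u x' \<partial>distr (path_law ?Z K (x, y)) MX (\<lambda>\<omega>. fst (\<omega> 1)))"
      by (rule nn_integral_distr[OF m, symmetric]) (simp add: u)
    also have "\<dots> = (\<integral>\<^sup>+x'. u x' \<partial>KX x)"
      unfolding A0[OF x y] KX.distr_path_law_1[OF x] ..
    finally show ?thesis .
  qed
  interpret C: modulated_chain MX KX V MY K
    by unfold_locales (use V proj in \<open>auto intro: pair_measureI\<close>)
  \<comment> \<open>The supremum is finite by (A2), so \<open>enn2real\<close> loses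
    nothing.\<close>
  define t where "t = enn2real (SUP x\<in>V. C.X.exc (\<lambda>_. 1) x)"
  have t: "C.X.exc (\<lambda>_. 1) x \<le> ennreal t" if "x \<in> V" for x
    unfolding t_def using Sup that by (subst ennreal_enn2real) (auto intro: SUP_upper)
  have t0: "0 \<le> t" by (simp add: t_def)
  define r where "r = enn2real U"
  have r: "U = ennreal r" "0 \<le> r" using B1(2) by (simp_all add: r_def)
  have Lm: "(\<lambda>w. L2 (snd w)) \<in> borel_measurable ?Z" by (rule measurable_compose[OF measurable_snd L2(1)])
  have jump: "(\<integral>\<^sup>+w. ennreal \<bar>L2 (snd w) - L2 (snd z)\<bar> \<partial>K z) \<le> ennreal r" if z: "z \<in> space ?Z" for z
  proof -
    have "(\<integral>\<^sup>+w. ennreal \<bar>L2 (snd w) - L2 (snd z)\<bar> \<partial>K z) =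
        (\<integral>\<^sup>+\<omega>. ennreal \<bar>L2 (snd (\<omega> 1)) - L2 (snd z)\<bar> \<partial>path_law ?Z K z)"
      by (rule KJ.nn_integral_path_law_1[OF z, symmetric]) (use Lm in measurable)
    \<comment> \<open>(B1) refers to the level at time 0, which is that of \<open>z\<close> almost
      surely.\<close>
    also have "\<dots> = (\<integral>\<^sup>+\<omega>. ennreal \<bar>L2 (snd (\<omega> 1)) - L2 (snd (\<omega> 0))\<bar> \<partial>path_law ?Z K z)"
      using KJ.AE_path_law_start[OF z Lm] by (intro nn_integral_cong_AE) auto
    also have "\<dots> \<le> ennreal r" unfolding r(1)[symmetric] using B1(1) z by (auto simp: SUP_le_iff)
    finally show ?thesis .
  qed
  \<comment> \<open>(B1) and (B2) give \<open>f \<ge> - r - h 0\<close> on the whole space, so this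
    shift makes \<open>F\<close> non-negative.\<close>
  define c where "c = r + h 0"
  have h0: "0 \<le> h 0" by (rule h(1)) simp
  have h_mono: "h b \<le> h a" if "0 \<le> a" "a \<le> b" for a b
    using h(2) that by (auto simp: monotone_on_def)
  have c: "0 \<le> c" using r h0 by (simp add: c_def)
  \<comment> \<open>By (B1) the mean increment never exceeds \<open>r\<close>, so truncating
    \<open>f\<close> at \<open>r\<close> preserves the drift inequality. It makes \<open>F\<close>
    bounded, as Kac's formula requires, and can only lower the mean.\<close>
  define F where "F x = min (f x) r + c" for x
  \<comment> \<open>A Bochner integral is 0 for a non-integrable function; (B1) supplies
    integrability, so the integral in (B2) is the true mean increment.\<close>
  have step: "(\<integral>\<^sup>+w. ennreal (L2 (snd w)) \<partial>K z) = ennreal (\<integral>w. L2 (snd w) \<partial>K z)"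
      "0 \<le> (\<integral>w. L2 (snd w) \<partial>K z)"
      "(\<integral>w. L2 (snd w) \<partial>K z) - L2 (snd z) \<le> f (fst z) + h (L2 (snd z))"
      "\<bar>(\<integral>w. L2 (snd w) \<partial>K z) - L2 (snd z)\<bar> \<le> r"
    if z: "z \<in> space ?Z" for z
  proof -
    interpret Kz: prob_space "K z" by (rule KJ.prob_space_kernel[OF z])
    have Lz: "(\<lambda>w. L2 (snd w)) \<in> borel_measurable (K z)" using Lm by (simp add: KJ.measurable_kernel_iff[OF z])
    have d: "integrable (K z) (\<lambda>w. L2 (snd w) - L2 (snd z))"
    proof (rule integrableI_bounded)
      show "(\<integral>\<^sup>+w. ennreal (norm (L2 (snd w) - L2 (snd z))) \<partial>K z) < \<infinity>"
        using le_less_trans[OF jump[OF z]] by simp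
    qed (use Lz in simp)
    have "integrable (K z) (\<lambda>w. (L2 (snd w) - L2 (snd z)) + L2 (snd z))"
      using d by (rule Bochner_Integration.integrable_add) simp
    then have i: "integrable (K z) (\<lambda>w. L2 (snd w))" by simp
    have nn: "AE w in K z. 0 \<le> L2 (snd w)"
      by (rule AE_I2) (auto simp: KJ.space_kernel[OF z] space_pair_measure intro: L2(2))
    show "(\<integral>\<^sup>+w. ennreal (L2 (snd w)) \<partial>K z) = ennreal (\<integral>w. L2 (snd w) \<partial>K z)"
      by (rule nn_integral_eq_integral[OF i nn])
    show "0 \<le> (\<integral>w. L2 (snd w) \<partial>K z)" by (rule integral_nonneg_AE[OF nn])
    have diff: "(\<integral>w. L2 (snd w) - L2 (snd z) \<partial>K z) = (\<integral>w. L2 (snd w) \<partial>K z) - L2 (snd z)"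
      using i by (simp add: Kz.prob_space)
    have "(\<integral>w. L2 (snd w) - L2 (snd z) \<partial>K z) = (\<integral>\<omega>. L2 (snd (\<omega> 1)) - L2 (snd z) \<partial>path_law ?Z K z)"
      unfolding KJ.distr_path_law_1[OF z, symmetric]
      by (rule integral_distr[OF KJ.measurable_path_coord[OF z]]) (use Lm in measurable)
    also have "\<dots> \<le> f (fst z) + h (L2 (snd z))"
      using B2[of "fst z" "snd z"] z by (auto simp: space_pair_measure)
    finally show "(\<integral>w. L2 (snd w) \<partial>K z) - L2 (snd z) \<le> f (fst z) + h (L2 (snd z))" by (simp only: diff)
    have "ennreal \<bar>\<integral>w. L2 (snd w) - L2 (snd z) \<partial>K z\<bar> \<le> (\<integral>\<^sup>+w. ennreal \<bar>L2 (snd w) - L2 (snd z)\<bar> \<partial>K z)"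
      using integral_norm_bound_ennreal[OF d] by simp
    also have "\<dots> \<le> ennreal r" by (rule jump[OF z])
    finally show "\<bar>(\<integral>w. L2 (snd w) \<partial>K z) - L2 (snd z)\<bar> \<le> r" using r(2) by (simp add: diff)
  qed
  have F0: "0 \<le> F x" if x: "x \<in> space MX" for x
  proof -
    have z: "(x, y0) \<in> space ?Z" using x y0 by (simp add: space_pair_measure)
    have "h (L2 y0) \<le> h 0" by (rule h_mono) (use L2(2)[OF y0] in auto)
    then show ?thesis using step(3,4)[OF z] r(2) h0 by (simp add: F_def c_def)
  qed
  have Fm: "(\<lambda>x. ennreal (F x)) \<in> borel_measurable MX"
    unfolding F_def[abs_def] using f(1) by measurable
  have F_le: "ennreal (F x) \<le> ennreal (r + c)" for x by (rule ennreal_leI) (simp add: F_def)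
  have drift: "(\<integral>\<^sup>+w. ennreal (L2 (snd w)) \<partial>K z) + ennreal c \<le>
      ennreal (L2 (snd z)) + (ennreal (F (fst z)) + ennreal (h N) + ennreal (h 0) * indicator {w. L2 (snd w) < N} z)"
    if N: "0 \<le> N" and z: "z \<in> space ?Z" for N z
  proof -
    have xy: "fst z \<in> space MX" "snd z \<in> space MY" using z by (auto simp: space_pair_measure)
    have l: "0 \<le> L2 (snd z)" by (rule L2(2)[OF xy(2)])
    let ?i = "if L2 (snd z) < N then 1 else 0 :: real"
    \<comment> \<open>By monotonicity \<open>h N\<close> suffices at levels from \<open>N\<close>
      on; below \<open>N\<close> the bound \<open>h 0\<close> is used.\<close>
    have "h (L2 (snd z)) \<le> h N + h 0 * ?i"
      using h_mono[OF order_refl l] h_mono[OF N, of "L2 (snd z)"] h(1)[OF N] by auto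
    then have "(\<integral>w. L2 (snd w) \<partial>K z) + c \<le> L2 (snd z) + (F (fst z) + h N + h 0 * ?i)"
      using step(3,4)[OF z] h(1)[OF l] by (auto simp: F_def min_def)
    then have "ennreal ((\<integral>w. L2 (snd w) \<partial>K z) + c) \<le> ennreal (L2 (snd z) + (F (fst z) + h N + h 0 * ?i))"
      by (rule ennreal_leI)
    then show ?thesis
      using step(1,2)[OF z] c l F0[OF xy(1)] h(1)[OF N] h0 by (auto simp: ennreal_plus indicator_def)
  qed
  have \<pi>s: "sets \<pi> = sets MX" and "prob_space \<pi>"
    using \<pi> by (auto simp: stationary_distribution_def space_prob_algebra)
  interpret \<pi>: prob_space \<pi> by fact
  have mean: "(\<integral>\<^sup>+x. ennreal (F x) \<partial>\<pi>) + ennreal \<epsilon> \<le> ennreal c"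
  proof -
    have i: "integrable \<pi> (\<lambda>x. min (f x) r)" using f(2) by (intro integrable_min) auto
    then have iF: "integrable \<pi> F" unfolding F_def[abs_def] by simp
    have nn: "AE x in \<pi>. 0 \<le> F x" by (rule AE_I2) (simp add: F0 sets_eq_imp_space_eq[OF \<pi>s])
    have "(\<integral>x. min (f x) r \<partial>\<pi>) \<le> (\<integral>x. f x \<partial>\<pi>)" using i f(2) by (intro integral_mono) auto
    moreover have "(\<integral>x. F x \<partial>\<pi>) = (\<integral>x. min (f x) r \<partial>\<pi>) + c"
      unfolding F_def using i by (simp add: \<pi>.prob_space)
    ultimately have le: "(\<integral>x. F x \<partial>\<pi>) + \<epsilon> \<le> c" using f(3) by simp
    have "(\<integral>\<^sup>+x. ennreal (F x) \<partial>\<pi>) + ennreal \<epsilon> = ennreal ((\<integral>x. F x \<partial>\<pi>) + \<epsilon>)"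
      unfolding nn_integral_eq_integral[OF iF nn]
      using integral_nonneg_AE[OF nn] f(4) by (simp add: ennreal_plus)
    also have "\<dots> \<le> ennreal c" by (rule ennreal_leI[OF le])
    finally show ?thesis .
  qed
  interpret \<mu>: prob_space \<mu> by (rule A3(3))
  \<comment> \<open>Mass one uses that \<open>ret\<close> fixes the constant 1 at every state, not
    only on \<open>V\<close>, since \<open>\<mu>\<close> lives on the whole space.\<close>
  have \<nu>: "averaging_operator MX V (\<lambda>u _. \<integral>\<^sup>+y. C.X.ret u y \<partial>\<mu>)"
  proof
    note mc = measurable_cong_sets[OF A3(4) refl]
    have sp: "space \<mu> = space MX" by (rule sets_eq_imp_space_eq[OF A3(4)])
    fix u v :: "'a \<Rightarrow> ennreal" and x a
    show "(\<lambda>_. \<integral>\<^sup>+y. C.X.ret u y \<partial>\<mu>) \<in> borel_measurable MX" by simp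
    {
      assume u: "u \<in> borel_measurable MX"
      note mu = C.X.ret.measurable_op[OF u]
      have "(\<integral>\<^sup>+y. C.X.ret (\<lambda>y. a * u y) y \<partial>\<mu>) = (\<integral>\<^sup>+y. a * C.X.ret u y \<partial>\<mu>)"
        by (rule nn_integral_cong) (simp add: sp C.X.ret.cmult[OF u])
      then show "(\<integral>\<^sup>+y. C.X.ret (\<lambda>y. a * u y) y \<partial>\<mu>) = a * (\<integral>\<^sup>+y. C.X.ret u y \<partial>\<mu>)"
        using mu by (simp add: nn_integral_cmult mc)
      assume v: "v \<in> borel_measurable MX"
      note mv = C.X.ret.measurable_op[OF v]
      have "(\<integral>\<^sup>+y. C.X.ret (\<lambda>y. u y + v y) y \<partial>\<mu>) = (\<integral>\<^sup>+y. C.X.ret u y + C.X.ret v y \<partial>\<mu>)"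
        by (rule nn_integral_cong) (simp add: sp C.X.ret.add[OF u v])
      then show "(\<integral>\<^sup>+y. C.X.ret (\<lambda>y. u y + v y) y \<partial>\<mu>) = (\<integral>\<^sup>+y. C.X.ret u y \<partial>\<mu>) + (\<integral>\<^sup>+y. C.X.ret v y \<partial>\<mu>)"
        using mu mv by (simp add: nn_integral_add mc)
    }
    show "(\<integral>\<^sup>+y. C.X.ret u y \<partial>\<mu>) \<le> (\<integral>\<^sup>+y. C.X.ret v y \<partial>\<mu>)" if "\<And>y. y \<in> V \<Longrightarrow> u y \<le> v y"
      by (rule nn_integral_mono) (simp add: sp C.X.ret.mono[OF that])
    show "V \<subseteq> space MX" by (rule C.X.V_subset)
    have "(\<integral>\<^sup>+y. C.X.ret (\<lambda>_. 1) y \<partial>\<mu>) = (\<integral>\<^sup>+y. 1 \<partial>\<mu>)"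
      by (rule nn_integral_cong) (simp add: sp C.X.ret_1 rec)
    then show "(\<integral>\<^sup>+y. C.X.ret (\<lambda>_. 1) y \<partial>\<mu>) = 1" using \<mu>.emeasure_space_1 by simp
  qed
  have q: "0 < p / 2 ^ m" "p / 2 ^ m \<le> 1"
    using A3(1,2) order_trans[OF A3(2) one_le_power[of "2::real" m]] by (auto simp: divide_le_eq)
  have minor: "ennreal (p / 2 ^ m) * (\<integral>\<^sup>+y. C.X.ret u y \<partial>\<mu>) \<le> (\<Sum>j<Suc m. (C.X.ret ^^ Suc j) u x)"
    if "u \<in> borel_measurable MX" "x \<in> V" for u x
    by (rule C.X.small_set_minorization[OF _ A3(4,3,6) that(2,1)]) (use A3(1) in auto)
  have "\<exists>n. \<exists>\<delta>>0. \<exists>G\<in>borel_measurable MX. (\<exists>B<top. \<forall>x\<in>V. G x \<le> B) \<and>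
      (\<forall>x\<in>V. C.X.ret G x + (C.X.exc (\<lambda>x. ennreal (F x)) x +
        ennreal (h 0) * C.X.exc ((C.X.avoid ^^ n) (\<lambda>_. 1)) x) + ennreal \<delta> \<le> G x + ennreal c * C.X.exc (\<lambda>_. 1) x)"
    by (rule C.X.exists_potential[OF \<pi> rec t t0 zero_less_Suc \<nu> q minor Fm F_le _ mean _ c h0])
       (use r(2) c f(4) in auto)
  then obtain n \<delta> G B where G: "0 < \<delta>" "G \<in> borel_measurable MX" "B < top" "\<And>x. x \<in> V \<Longrightarrow> G x \<le> B"
    and pot: "\<And>x. x \<in> V \<Longrightarrow> C.X.ret G x + (C.X.exc (\<lambda>x. ennreal (F x)) x +
        ennreal (h 0) * C.X.exc ((C.X.avoid ^^ n) (\<lambda>_. 1)) x) + ennreal \<delta> \<le> G x + ennreal c * C.X.exc (\<lambda>_. 1) x"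
    by blast
  show ?thesis
    by (rule C.positive_recurrent_level_set[OF rec t t0 L2(1) jump r(2) h(3) h0 Fm F_le _ drift G pot])
       (use r(2) c in auto)
qed

end
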